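(* Let $H$ be a homogeneous elliptic operator of order $2m$ with real constant coefficients on $\mathbb{R}^n$. Then for any open convex set $\Omega\subseteq\mathbb{R}^n$ with nonempty boundary and all $u\in C^\infty_c(\Omega)$ (real-valued), $$\int_\Omega u(x)\,Hu(x)\,dx\ \ge\ A(m)\,\frac{\mu_H}{M_H}\int_\Omega\frac{u^2(x)}{d_H^{2m}(x)}\,dx.$$
   Context: $H=(-1)^m\sum_{|\alpha|=2m}a_\alpha D^\alpha$ with real constants $a_\alpha$; symbol $H(\xi)=\sum_{|\alpha|=2m}a_\alpha\xi^\alpha$, with $H(\xi)>0$ for $\xi\ne0$ (ellipticity). $F_H(\xi)=H(\xi)^{1/(2m)}$, $F_H^*(\omega)=\sup_{\xi\neq0}\frac{\omega\cdot\xi}{F_H(\xi)}$, $F_H^{**}(\xi)=\sup_{\omega\neq0}\frac{\xi\cdot\omega}{F_H^*(\omega)}$. $d_H(x)=\min\{F_H^*(x-y):y\in\partial\Omega\}$ for $x\in\Omega$. With $d\sigma$ the normalized surface measure on $S^{n-1}$, $\mu_H$ and $M_H$ are the best (positive) constants in $$\mu_H\,F_H^{**}(\xi)^{2m}\le\int_{S^{n-1}}\frac{(\xi\cdot\omega)^{2m}}{F_H^*(\omega)^{2m}}\,d\sigma(\omega)\le M_H\,H(\xi),\qquad \xi\in\mathbb{R}^n,$$ i.e. $\mu_H$ is the largest constant for the left inequality and $M_H$ the smallest for the right one. $A(m)=\frac{(2m-1)^2(2m-3)^2\cdots1^2}{4^m}$. *)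

theory Defs
  imports "HOL-Analysis.Analysis"
begin

definition mi_order :: "('n::finite \<Rightarrow> nat) \<Rightarrow> nat" where
  "mi_order \<alpha> = (\<Sum>i\<in>UNIV. \<alpha> i)"

definition multi_indices :: "nat \<Rightarrow> ('n::finite \<Rightarrow> nat) set" where
  "multi_indices k = {\<alpha>. mi_order \<alpha> = k}"

definition partial_d :: "'n::finite \<Rightarrow> (real^'n \<Rightarrow> real) \<Rightarrow> real^'n \<Rightarrow> real" where
  "partial_d i f x = deriv (\<lambda>t. f (x + t *\<^sub>R axis i 1)) 0"

definition iter_partial :: "'n::finite list \<Rightarrow> (real^'n \<Rightarrow> real) \<Rightarrow> real^'n \<Rightarrow> real" where
  "iter_partial L f = foldr partial_d L f"

text \<open>D^alpha: iterated partial derivatives, alpha i times in direction i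
  (the order is irrelevant for smooth functions).\<close>
definition Dalpha :: "('n::finite \<Rightarrow> nat) \<Rightarrow> (real^'n \<Rightarrow> real) \<Rightarrow> real^'n \<Rightarrow> real" where
  "Dalpha \<alpha> f = iter_partial (SOME L. \<forall>i. count_list L i = \<alpha> i) f"

definition smooth_fun :: "(real^'n::finite \<Rightarrow> real) \<Rightarrow> bool" where
  "smooth_fun f \<longleftrightarrow> (\<forall>L. iter_partial L f differentiable_on UNIV)"

definition compact_support_in :: "(real^'n::finite \<Rightarrow> real) \<Rightarrow> (real^'n) set \<Rightarrow> bool" where
  "compact_support_in u \<Omega> \<longleftrightarrow>
     compact (closure {x. u x \<noteq> 0}) \<and> closure {x. u x \<noteq> 0} \<subseteq> \<Omega>"

definition op_H :: "nat \<Rightarrow> (('n::finite \<Rightarrow> nat) \<Rightarrow> real) \<Rightarrow> (real^'n \<Rightarrow> real) \<Rightarrow> real^'n \<Rightarrow> real" where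
  "op_H m a u x = (-1)^m * (\<Sum>\<alpha>\<in>multi_indices (2*m). a \<alpha> * Dalpha \<alpha> u x)"

definition symb_H :: "nat \<Rightarrow> (('n::finite \<Rightarrow> nat) \<Rightarrow> real) \<Rightarrow> real^'n \<Rightarrow> real" where
  "symb_H m a \<xi> = (\<Sum>\<alpha>\<in>multi_indices (2*m). a \<alpha> * (\<Prod>i\<in>UNIV. (\<xi> $ i) ^ \<alpha> i))"

definition F_H :: "nat \<Rightarrow> (('n::finite \<Rightarrow> nat) \<Rightarrow> real) \<Rightarrow> real^'n \<Rightarrow> real" where
  "F_H m a \<xi> = symb_H m a \<xi> powr (1 / (2 * real m))"

definition F_H_star :: "nat \<Rightarrow> (('n::finite \<Rightarrow> nat) \<Rightarrow> real) \<Rightarrow> real^'n \<Rightarrow> real" where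
  "F_H_star m a \<omega> = (SUP \<xi>\<in>UNIV - {0}. (\<omega> \<bullet> \<xi>) / F_H m a \<xi>)"

definition F_H_star2 :: "nat \<Rightarrow> (('n::finite \<Rightarrow> nat) \<Rightarrow> real) \<Rightarrow> real^'n \<Rightarrow> real" where
  "F_H_star2 m a \<xi> = (SUP \<omega>\<in>UNIV - {0}. (\<xi> \<bullet> \<omega>) / F_H_star m a \<omega>)"

definition d_H :: "nat \<Rightarrow> (('n::finite \<Rightarrow> nat) \<Rightarrow> real) \<Rightarrow> (real^'n) set \<Rightarrow> real^'n \<Rightarrow> real" where
  "d_H m a \<Omega> x = (INF y\<in>frontier \<Omega>. F_H_star m a (x - y))"

text \<open>Integral against the normalized surface measure on S^{n-1}, realized as the
  push-forward of normalized Lebesgue measure on the unit ball under the radial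
  projection w |-> w/|w| (polar coordinates).\<close>
definition sphere_avg :: "(real^'n::finite \<Rightarrow> real) \<Rightarrow> real" where
  "sphere_avg g = integral (ball 0 1) (\<lambda>\<omega>. g (\<omega> /\<^sub>R norm \<omega>)) / measure lebesgue (ball (0::real^'n) 1)"

definition sph_int :: "nat \<Rightarrow> (('n::finite \<Rightarrow> nat) \<Rightarrow> real) \<Rightarrow> real^'n \<Rightarrow> real" where
  "sph_int m a \<xi> = sphere_avg (\<lambda>\<omega>. (\<xi> \<bullet> \<omega>) ^ (2*m) / F_H_star m a \<omega> ^ (2*m))"

definition mu_H :: "nat \<Rightarrow> (('n::finite \<Rightarrow> nat) \<Rightarrow> real) \<Rightarrow> real" where
  "mu_H m (a :: ('n \<Rightarrow> nat) \<Rightarrow> real) = Sup {\<mu>. \<mu> > 0 \<and>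
     (\<forall>\<xi>::real^'n. \<mu> * F_H_star2 m a \<xi> ^ (2*m) \<le> sph_int m a \<xi>)}"

definition M_H :: "nat \<Rightarrow> (('n::finite \<Rightarrow> nat) \<Rightarrow> real) \<Rightarrow> real" where
  "M_H m (a :: ('n \<Rightarrow> nat) \<Rightarrow> real) = Inf {M. M > 0 \<and>
     (\<forall>\<xi>::real^'n. sph_int m a \<xi> \<le> M * symb_H m a \<xi>)}"

definition A_const :: "nat \<Rightarrow> real" where
  "A_const m = (\<Prod>k=1..m. (2 * real k - 1)^2) / 4^m"

end

theory Submission
  imports Defs
begin

text \<open>
  The idea is Davies' mean-distance method. On every line in a unit direction \<open>\<omega>\<close> the one-dimensional
  Hardy-Rellich inequality with constant \<open>A(m)\<close> bounds the integral of \<open>(\<partial>\<^sub>\<omega>\<^sup>m u)\<^sup>2\<close> from below; one divides by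
  \<open>F\<^sub>H\<^sup>*(\<omega>)\<^sup>2\<^sup>m\<close> and averages over the sphere. On the differential side the average is the quadratic form with symbol
  the spherical integral of the definition of \<open>M\<^sub>H\<close>, hence at most \<open>M\<^sub>H\<close> times the form of \<open>H\<close>. On the weight side,
  if \<open>\<nu>\<close> is normal to a supporting hyperplane at a boundary point \<open>y\<close>, then the line through \<open>x\<close> in direction \<open>\<omega>\<close>
  leaves \<open>\<Omega>\<close> within distance \<open>\<nu> \<bullet> (y - x) / \<bar>\<nu> \<bullet> \<omega>\<bar>\<close>, so the average is at least
  \<open>\<mu>\<^sub>H (F\<^sub>H\<^sup>*\<^sup>*(\<nu>) / (\<nu> \<bullet> (y - x)))\<^sup>2\<^sup>m\<close>, which is at least \<open>\<mu>\<^sub>H / F\<^sub>H\<^sup>*(x - y)\<^sup>2\<^sup>m\<close>.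

  That a nonnegative symbol gives a nonnegative quadratic form is proved without the Fourier transform:
  central differences with step \<open>h\<close> have the symbol \<open>i sin(h \<xi>\<^sub>j)\<close>, so the discretised form has a nonnegative
  trigonometric symbol, and pairing it with the positive definite autocorrelation of \<open>u\<close> on a lattice is nonnegative by
  finite Fourier sums; then \<open>h\<close> tends to \<open>0\<close>.
\<close>

subsection \<open>Nonnegative trigonometric symbols on a lattice\<close>

definition lat_axis :: "'n \<Rightarrow> 'n \<Rightarrow> int" where
  "lat_axis i = (\<lambda>j. if j = i then 1 else 0)"

text \<open>The factor 1/2 gives this central difference the symbol i sin(\<theta>_i) on
  characters.\<close>

definition lat_diff :: "'n \<Rightarrow> (('n \<Rightarrow> int) \<Rightarrow> real) \<Rightarrow> ('n \<Rightarrow> int) \<Rightarrow> real" where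
  "lat_diff i g k = (g (\<lambda>j. k j + lat_axis i j) - g (\<lambda>j. k j - lat_axis i j)) / 2"

definition lat_char :: "('n::finite \<Rightarrow> real) \<Rightarrow> ('n \<Rightarrow> int) \<Rightarrow> complex" where
  "lat_char \<theta> k = cis (\<Sum>i\<in>UNIV. \<theta> i * of_int (k i))"

lemma lat_char_add: "lat_char \<theta> (\<lambda>j. k j + l j) = lat_char \<theta> k * lat_char \<theta> l"
  by (simp add: lat_char_def cis_mult sum.distrib ring_distribs)

lemma lat_char_diff: "lat_char \<theta> (\<lambda>j. k j - l j) = lat_char \<theta> k * cnj (lat_char \<theta> l)"
  by (simp add: lat_char_def cis_cnj cis_mult sum_subtractf ring_distribs)

lemma lat_char_axis: "lat_char \<theta> (lat_axis i) = cis (\<theta> i)"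
  by (simp add: lat_char_def lat_axis_def if_distrib sum.delta' cong: if_cong)

text \<open>Trades a sine factor for a difference of characters at two neighbouring lattice points;
  this drives the induction on words of differences below.\<close>

lemma sin_lat_char:
  "complex_of_real (sin (\<theta> i)) * lat_char \<theta> k
     = (lat_char \<theta> (\<lambda>j. k j + lat_axis i j) - lat_char \<theta> (\<lambda>j. k j - lat_axis i j)) / (2 * \<i>)"
proof -
  have "cis t - cnj (cis t) = 2 * \<i> * complex_of_real (sin t)" for t
    by (simp add: complex_eq_iff)
  then have "lat_char \<theta> (\<lambda>j. k j + lat_axis i j) - lat_char \<theta> (\<lambda>j. k j - lat_axis i j)
     = lat_char \<theta> k * (2 * \<i> * complex_of_real (sin (\<theta> i)))"
    by (simp add: lat_char_add lat_char_diff lat_char_axis flip: right_diff_distrib)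
  then show ?thesis by (simp add: algebra_simps)
qed

section \<open>Finite Fourier sums and Fejer means\<close>

definition freqs :: "nat \<Rightarrow> ('n::finite \<Rightarrow> real) set" where
  "freqs P = PiE UNIV (\<lambda>_. (\<lambda>t. 2 * pi * real t / real P) ` {..<P})"

definition lat_box :: "nat \<Rightarrow> ('n::finite \<Rightarrow> int) set" where
  "lat_box N = PiE UNIV (\<lambda>_. {0..<int N})"

lemma finite_lat_box [simp]: "finite (lat_box N :: ('n::finite \<Rightarrow> int) set)"
  unfolding lat_box_def by (intro finite_PiE) auto

text \<open>A geometric sum of powers of a root of unity. The bound on \<open>q\<close> rules out
  nonzero multiples of \<open>P\<close>, so the root is 1 only for \<open>q = 0\<close>.\<close>

lemma sum_cis_roots:
  fixes q :: int
  assumes "\<bar>q\<bar> < int P"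
  shows "(\<Sum>t\<in>(\<lambda>t. 2 * pi * real t / real P) ` {..<P}. cis (t * of_int q)) = (if q = 0 then of_nat P else 0)"
proof -
  have P: "P > 0" using assms by auto
  have pw: "cis (2 * pi * of_int q / real P) ^ t = cis (2 * pi * real t / real P * of_int q)" for t
    by (subst Complex.DeMoivre, rule arg_cong[where f = cis]) simp
  have "inj_on (\<lambda>t. 2 * pi * real t / real P) {..<P}"
    using P by (auto simp: inj_on_def)
  then have "(\<Sum>t\<in>(\<lambda>t. 2 * pi * real t / real P) ` {..<P}. cis (t * of_int q))
     = (\<Sum>t<P. cis (2 * pi * of_int q / real P) ^ t)"
    by (subst sum.reindex) (auto simp: pw)
  also have "\<dots> = (if q = 0 then of_nat P else 0)"
  proof (cases "q = 0")
    case False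
    have ne: "cis (2 * pi * of_int q / real P) \<noteq> 1"
    proof
      assume "cis (2 * pi * of_int q / real P) = 1"
      then have "exp (\<i> * complex_of_real (2 * pi * of_int q / real P)) = 1"
        by (simp add: cis_conv_exp)
      then obtain n :: int where "2 * pi * of_int q / real P = of_int (2 * n) * pi"
        unfolding exp_eq_1 by auto
      then have "real_of_int q = of_int (n * int P)" using P by (simp add: field_simps)
      then have "q = n * int P" using of_int_eq_iff by blast
      then have "int P dvd q" by simp
      with False assms show False using zdvd_imp_le[of "int P" "\<bar>q\<bar>"] by auto
    qed
    have "cis (2 * pi * of_int q / real P) ^ P = 1"
      using P unfolding pw by simp
    then show ?thesis using ne False by (simp add: sum_gp_strict)
  qed simp
  finally show ?thesis .
qed

text \<open>Characters factor over the coordinates, so the sum over the grid is a product of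
  one-dimensional sums.\<close>

lemma sum_lat_char:
  fixes q :: "'n::finite \<Rightarrow> int"
  assumes "\<And>i. \<bar>q i\<bar> < int P"
  shows "(\<Sum>\<theta>\<in>freqs P. lat_char \<theta> q) = (if q = (\<lambda>_. 0) then of_nat P ^ CARD('n) else 0)"
proof -
  have cisprod: "cis (\<Sum>i\<in>A. f i) = (\<Prod>i\<in>A. cis (f i))" if "finite A" for A and f :: "'n \<Rightarrow> real"
    using that by (induction A) (simp_all flip: cis_mult)
  have "(\<Sum>\<theta>\<in>freqs P. lat_char \<theta> q) = (\<Sum>\<theta>\<in>freqs P. \<Prod>i\<in>UNIV. cis (\<theta> i * of_int (q i)))"
    by (simp add: lat_char_def cisprod)
  also have "\<dots> = (\<Prod>i\<in>UNIV. \<Sum>t\<in>(\<lambda>t. 2 * pi * real t / real P) ` {..<P}. cis (t * of_int (q i)))"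
    unfolding freqs_def by (subst prod_sum_PiE) auto
  also have "\<dots> = (\<Prod>i\<in>(UNIV::'n set). if q i = 0 then of_nat P else 0)"
    using assms by (intro prod.cong sum_cis_roots refl) auto
  also have "\<dots> = (if q = (\<lambda>_. 0) then of_nat P ^ CARD('n) else 0)"
    by (auto simp: fun_eq_iff intro!: prod_zero)
  finally show ?thesis .
qed

text \<open>The Cesaro mean of the Fourier series with coefficients \<open>g\<close>, written as a
  double sum over a box. In this form it is a Hermitian form in the values of a character, which is
  where positive definiteness of \<open>g\<close> enters.\<close>

definition fejer :: "nat \<Rightarrow> (('n::finite \<Rightarrow> int) \<Rightarrow> real) \<Rightarrow> ('n \<Rightarrow> real) \<Rightarrow> complex" where
  "fejer N g \<theta> = (\<Sum>j\<in>lat_box N. \<Sum>l\<in>lat_box N. complex_of_real (g (\<lambda>i. j i - l i)) * lat_char \<theta> (\<lambda>i. l i - j i)) / of_nat N ^ CARD('n)"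

text \<open>The \<open>3N\<close> grid points per coordinate are enough to exclude aliasing against the frequencies of
  the Fejer kernel, which lie in \<open>(-N, N)\<close>.\<close>

definition spec_avg :: "nat \<Rightarrow> (('n::finite \<Rightarrow> int) \<Rightarrow> real) \<Rightarrow> (('n \<Rightarrow> real) \<Rightarrow> complex) \<Rightarrow> complex" where
  "spec_avg N g p = (\<Sum>\<theta>\<in>freqs (3 * N). p \<theta> * fejer N g \<theta>) / of_nat (3 * N) ^ CARD('n)"

text \<open>Counts the pairs in the box with difference \<open>c\<close>; divided by
  \<open>N\<close> this is the triangular Fejer weight.\<close>

lemma card_overlap:
  fixes c :: int
  assumes "\<bar>c\<bar> \<le> int N"
  shows "card {l \<in> {0..<int N}. l + c \<in> {0..<int N}} = nat (int N - \<bar>c\<bar>)"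
proof -
  have "{l \<in> {0..<int N}. l + c \<in> {0..<int N}} = {max 0 (-c)..<min (int N) (int N - c)}"
    by auto
  then show ?thesis using assms by (auto simp: max_def min_def abs_if)
qed

text \<open>By orthogonality only the pairs with \<open>j = l + k\<close> survive. All of them carry
  the coefficient \<open>g k\<close>, and their number relative to the size of the box is the
  product of the triangular weights.\<close>

lemma spec_avg_lat_char:
  fixes k :: "'n::finite \<Rightarrow> int"
  assumes N: "N > 0" and k: "\<And>i. \<bar>k i\<bar> \<le> int N"
  shows "spec_avg N g (\<lambda>\<theta>. lat_char \<theta> k) = of_real (g k * (\<Prod>i\<in>UNIV. 1 - \<bar>real_of_int (k i)\<bar> / real N))"
proof -
  let ?B = "lat_box N :: ('n \<Rightarrow> int) set"
  let ?P = "of_nat (3 * N) ^ CARD('n) :: complex"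
  have fj: "fejer N g \<theta> * of_nat N ^ CARD('n) = (\<Sum>j\<in>?B. \<Sum>l\<in>?B. complex_of_real (g (\<lambda>i. j i - l i)) * lat_char \<theta> (\<lambda>i. l i - j i))" for \<theta>
    using N by (simp add: fejer_def)
  have "(\<Sum>\<theta>\<in>freqs (3 * N). lat_char \<theta> k * fejer N g \<theta>) * of_nat N ^ CARD('n)
     = (\<Sum>\<theta>\<in>freqs (3 * N). \<Sum>j\<in>?B. \<Sum>l\<in>?B. complex_of_real (g (\<lambda>i. j i - l i)) * lat_char \<theta> (\<lambda>i. k i + (l i - j i)))"
    unfolding sum_distrib_right mult.assoc fj
    by (simp add: sum_distrib_left lat_char_add mult_ac)
  also have "\<dots> = (\<Sum>j\<in>?B. \<Sum>l\<in>?B. complex_of_real (g (\<lambda>i. j i - l i)) * (\<Sum>\<theta>\<in>freqs (3 * N). lat_char \<theta> (\<lambda>i. k i + (l i - j i))))"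
    by (subst sum.swap, rule sum.cong[OF refl], subst sum.swap) (simp add: sum_distrib_left)
  also have "\<dots> = (\<Sum>j\<in>?B. \<Sum>l\<in>?B. if j = (\<lambda>i. l i + k i) then of_real (g k) * ?P else 0)"
  proof (intro sum.cong refl)
    fix j l assume jl: "j \<in> ?B" "l \<in> ?B"
    \<comment> \<open>The first summand is at most \<open>N\<close> and the difference at most
      \<open>N - 1\<close> in absolute value.\<close>
    have *: "\<bar>k i + (l i - j i)\<bar> < int (3 * N)" for i
    proof -
      have "j i \<in> {0..<int N}" "l i \<in> {0..<int N}" using jl by (auto simp: lat_box_def PiE_iff)
      then show ?thesis using k[of i] by auto
    qed
    have eq: "(\<lambda>i. k i + (l i - j i)) = (\<lambda>_. 0) \<longleftrightarrow> j = (\<lambda>i. l i + k i)"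
      by (auto simp: fun_eq_iff algebra_simps)
    show "complex_of_real (g (\<lambda>i. j i - l i)) * (\<Sum>\<theta>\<in>freqs (3 * N). lat_char \<theta> (\<lambda>i. k i + (l i - j i)))
       = (if j = (\<lambda>i. l i + k i) then of_real (g k) * ?P else 0)"
      unfolding sum_lat_char[OF *] eq by auto
  qed
  also have "\<dots> = (\<Sum>l\<in>?B. if (\<lambda>i. l i + k i) \<in> ?B then of_real (g k) * ?P else 0)"
    by (subst sum.swap) (simp add: sum.delta')
  also have "\<dots> = of_nat (card {l \<in> ?B. (\<lambda>i. l i + k i) \<in> ?B}) * (of_real (g k) * ?P)"
    by (simp add: sum.If_cases Int_def conj_commute)
  also have "{l \<in> ?B. (\<lambda>i. l i + k i) \<in> ?B} = PiE UNIV (\<lambda>i. {l \<in> {0..<int N}. l + k i \<in> {0..<int N}})"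
    by (auto simp: lat_box_def PiE_iff)
  also have "card \<dots> = (\<Prod>i\<in>UNIV. nat (int N - \<bar>k i\<bar>))"
    using card_overlap[OF k] by (subst card_PiE) auto
  finally have "(\<Sum>\<theta>\<in>freqs (3 * N). lat_char \<theta> k * fejer N g \<theta>) * of_nat N ^ CARD('n) = of_nat (\<Prod>i\<in>UNIV. nat (int N - \<bar>k i\<bar>)) * (of_real (g k) * ?P)" .
  moreover have "complex_of_nat (\<Prod>i\<in>UNIV. nat (int N - \<bar>k i\<bar>)) = of_real ((\<Prod>i\<in>UNIV. 1 - \<bar>real_of_int (k i)\<bar> / real N) * real N ^ CARD('n))"
  proof -
    have "(\<Prod>i\<in>UNIV. 1 - \<bar>real_of_int (k i)\<bar> / real N) * real N ^ CARD('n) = (\<Prod>i\<in>UNIV. (1 - \<bar>real_of_int (k i)\<bar> / real N) * real N)"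
      by (simp add: prod.distrib)
    also have "\<dots> = (\<Prod>i\<in>UNIV. real (nat (int N - \<bar>k i\<bar>)))"
      using N k by (intro prod.cong refl) (auto simp: field_simps of_nat_nat)
    finally show ?thesis by (simp flip: of_nat_prod)
  qed
  ultimately have "(\<Sum>\<theta>\<in>freqs (3 * N). lat_char \<theta> k * fejer N g \<theta>) * of_nat N ^ CARD('n)
     = (of_real (g k * (\<Prod>i\<in>UNIV. 1 - \<bar>real_of_int (k i)\<bar> / real N)) * ?P) * of_nat N ^ CARD('n)"
    by (simp only: of_real_mult of_real_power of_real_of_nat_eq mult_ac)
  then have "(\<Sum>\<theta>\<in>freqs (3 * N). lat_char \<theta> k * fejer N g \<theta>)
     = of_real (g k * (\<Prod>i\<in>UNIV. 1 - \<bar>real_of_int (k i)\<bar> / real N)) * ?P"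
    using N by (subst (asm) mult_right_cancel) auto
  then show ?thesis using N unfolding spec_avg_def
    by (subst nonzero_divide_eq_eq) auto
qed

text \<open>For fixed \<open>k\<close> every triangular weight tends to 1.\<close>

lemma spec_avg_lat_char_tendsto:
  fixes k :: "'n::finite \<Rightarrow> int"
  shows "(\<lambda>N. spec_avg N g (\<lambda>\<theta>. lat_char \<theta> k)) \<longlonglongrightarrow> of_real (g k)"
proof -
  have "(\<lambda>N. \<bar>real_of_int c\<bar> / real N) \<longlonglongrightarrow> 0" for c
    by (rule lim_const_over_n)
  then have "(\<lambda>N. of_real (g k * (\<Prod>i\<in>UNIV. 1 - \<bar>real_of_int (k i)\<bar> / real N))) \<longlonglongrightarrow> (of_real (g k * (\<Prod>i\<in>(UNIV::'n set). 1 - 0)) :: complex)"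
    by (intro tendsto_intros)
  moreover have "\<forall>\<^sub>F N in sequentially. spec_avg N g (\<lambda>\<theta>. lat_char \<theta> k) = of_real (g k * (\<Prod>i\<in>UNIV. 1 - \<bar>real_of_int (k i)\<bar> / real N))"
  proof -
    have "\<forall>\<^sub>F N in sequentially. \<bar>k i\<bar> \<le> int N" for i
      using eventually_ge_at_top[of "nat \<bar>k i\<bar>"] by eventually_elim auto
    then have "\<forall>\<^sub>F N in sequentially. \<forall>i. \<bar>k i\<bar> \<le> int N" by (rule eventually_all_finite)
    then show ?thesis using eventually_gt_at_top[of 0]
      by eventually_elim (simp add: spec_avg_lat_char)
  qed
  ultimately show ?thesis by (subst tendsto_cong) auto
qed

text \<open>Each sine becomes a difference of two shifts of \<open>k\<close> divided by 2i, that is,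
  one \<open>lat_diff\<close> divided by i. Hence \<open>k\<close> must be arbitrary in the
  induction.\<close>

lemma spec_avg_sin_tendsto:
  fixes g :: "('n::finite \<Rightarrow> int) \<Rightarrow> real"
  shows "(\<lambda>N. spec_avg N g (\<lambda>\<theta>. (\<Prod>i\<leftarrow>L. complex_of_real (sin (\<theta> i))) * lat_char \<theta> k))
          \<longlonglongrightarrow> of_real (foldr lat_diff L g k) / \<i> ^ length L"
proof (induction L arbitrary: k)
  case Nil
  then show ?case using spec_avg_lat_char_tendsto by simp
next
  case (Cons i L)
  let ?p = "\<lambda>\<theta>. \<Prod>i\<leftarrow>L. complex_of_real (sin (\<theta> i))"
  let ?kp = "\<lambda>j. k j + lat_axis i j" and ?km = "\<lambda>j. k j - lat_axis i j"
  have "(\<lambda>N. (spec_avg N g (\<lambda>\<theta>. ?p \<theta> * lat_char \<theta> ?kp) - spec_avg N g (\<lambda>\<theta>. ?p \<theta> * lat_char \<theta> ?km)) / (2 * \<i>))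
     \<longlonglongrightarrow> (of_real (foldr lat_diff L g ?kp) / \<i> ^ length L - of_real (foldr lat_diff L g ?km) / \<i> ^ length L) / (2 * \<i>)"
    by (intro tendsto_intros Cons.IH) auto
  also have "(of_real (foldr lat_diff L g ?kp) / \<i> ^ length L - of_real (foldr lat_diff L g ?km) / \<i> ^ length L) / (2 * \<i>)
     = of_real (foldr lat_diff (i # L) g k) / \<i> ^ length (i # L)"
    by (simp add: lat_diff_def field_simps)
  also have "(\<lambda>N. (spec_avg N g (\<lambda>\<theta>. ?p \<theta> * lat_char \<theta> ?kp) - spec_avg N g (\<lambda>\<theta>. ?p \<theta> * lat_char \<theta> ?km)) / (2 * \<i>))
     = (\<lambda>N. spec_avg N g (\<lambda>\<theta>. (\<Prod>i\<leftarrow>i # L. complex_of_real (sin (\<theta> i))) * lat_char \<theta> k))"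
  proof
    fix N
    have aux: "(b / p - c / p) / d = ((b - c) / d) / p" for b c d p :: complex
      by (simp add: diff_divide_distrib mult.commute)
    have "(\<Sum>\<theta>\<in>freqs (3*N). ((\<Prod>i\<leftarrow>i # L. complex_of_real (sin (\<theta> i))) * lat_char \<theta> k) * fejer N g \<theta>)
       = (\<Sum>\<theta>\<in>freqs (3*N). ?p \<theta> * ((lat_char \<theta> ?kp - lat_char \<theta> ?km) / (2 * \<i>)) * fejer N g \<theta>)"
      by (intro sum.cong refl) (simp only: list.map prod_list.Cons mult.assoc mult.left_commute flip: sin_lat_char)
    also have "\<dots> = ((\<Sum>\<theta>\<in>freqs (3*N). ?p \<theta> * lat_char \<theta> ?kp * fejer N g \<theta>) - (\<Sum>\<theta>\<in>freqs (3*N). ?p \<theta> * lat_char \<theta> ?km * fejer N g \<theta>)) / (2 * \<i>)"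
      by (simp add: sum_subtractf[symmetric] sum_divide_distrib diff_divide_distrib algebra_simps)
    finally show "(spec_avg N g (\<lambda>\<theta>. ?p \<theta> * lat_char \<theta> ?kp) - spec_avg N g (\<lambda>\<theta>. ?p \<theta> * lat_char \<theta> ?km)) / (2 * \<i>)
       = spec_avg N g (\<lambda>\<theta>. (\<Prod>i\<leftarrow>i # L. complex_of_real (sin (\<theta> i))) * lat_char \<theta> k)"
      unfolding spec_avg_def by (simp only: aux)
  qed
  finally show ?case .
qed

text \<open>Real weights suffice: for real \<open>g\<close> the real part of the form with complex
  weights splits into the forms of their real and imaginary parts.\<close>

definition pos_def_lat :: "(('n \<Rightarrow> int) \<Rightarrow> real) \<Rightarrow> bool" where
  "pos_def_lat g \<longleftrightarrow> (\<forall>J (w :: ('n \<Rightarrow> int) \<Rightarrow> real). finite J \<longrightarrow> (\<Sum>j\<in>J. \<Sum>l\<in>J. w j * w l * g (\<lambda>i. j i - l i)) \<ge> 0)"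

lemma Re_fejer_nonneg:
  fixes g :: "('n::finite \<Rightarrow> int) \<Rightarrow> real"
  assumes "pos_def_lat g"
  shows "Re (fejer N g \<theta>) \<ge> 0"
proof -
  let ?B = "lat_box N :: ('n \<Rightarrow> int) set"
  have pd: "(\<Sum>j\<in>?B. \<Sum>l\<in>?B. w j * w l * g (\<lambda>i. j i - l i)) \<ge> 0" for w
    using assms unfolding pos_def_lat_def by simp
  have "Re (\<Sum>j\<in>?B. \<Sum>l\<in>?B. complex_of_real (g (\<lambda>i. j i - l i)) * lat_char \<theta> (\<lambda>i. l i - j i))
    = (\<Sum>j\<in>?B. \<Sum>l\<in>?B. Re (lat_char \<theta> j) * Re (lat_char \<theta> l) * g (\<lambda>i. j i - l i))
     + (\<Sum>j\<in>?B. \<Sum>l\<in>?B. Im (lat_char \<theta> j) * Im (lat_char \<theta> l) * g (\<lambda>i. j i - l i))"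
    unfolding sum.distrib[symmetric] Re_sum
    by (intro sum.cong refl) (simp add: lat_char_diff algebra_simps)
  also have "\<dots> \<ge> 0" using pd[of "\<lambda>j. Re (lat_char \<theta> j)"] pd[of "\<lambda>j. Im (lat_char \<theta> j)"] by simp
  finally have *: "Re (\<Sum>j\<in>?B. \<Sum>l\<in>?B. complex_of_real (g (\<lambda>i. j i - l i)) * lat_char \<theta> (\<lambda>i. l i - j i)) \<ge> 0" .
  have "fejer N g \<theta> = (\<Sum>j\<in>?B. \<Sum>l\<in>?B. complex_of_real (g (\<lambda>i. j i - l i)) * lat_char \<theta> (\<lambda>i. l i - j i)) / of_real (real N ^ CARD('n))"
    by (simp add: fejer_def)
  then show ?thesis using * by (simp only: Re_divide_of_real) simp
qed

text \<open>At \<xi>_i = sin(\<theta>_i) the symbol is nonnegative, and so is its average against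
  the real part of the Fejer mean. Letting \<open>N\<close> grow turns the average into the
  differences at the origin, with i^(2m) = (-1)^m supplying the sign. The index set \<open>S\<close>
  lets coefficients of different origin share a word.\<close>

lemma lattice_positivity:
  fixes g :: "('n::finite \<Rightarrow> int) \<Rightarrow> real" and c :: "'s \<Rightarrow> real" and L :: "'s \<Rightarrow> 'n list"
  assumes pd: "pos_def_lat g" and S: "finite S"
    and len: "\<And>s. s \<in> S \<Longrightarrow> length (L s) = 2 * m"
    and nonneg: "\<And>\<xi> :: 'n \<Rightarrow> real. (\<Sum>s\<in>S. c s * (\<Prod>i\<leftarrow>L s. \<xi> i)) \<ge> 0"
  shows "(-1)^m * (\<Sum>s\<in>S. c s * foldr lat_diff (L s) g (\<lambda>_. 0)) \<ge> 0"
proof -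
  let ?T = "\<lambda>N s. spec_avg N g (\<lambda>\<theta>. (\<Prod>i\<leftarrow>L s. complex_of_real (sin (\<theta> i))) * lat_char \<theta> (\<lambda>_. 0))"
  have "(\<lambda>N. Re (\<Sum>s\<in>S. of_real (c s) * ?T N s)) \<longlonglongrightarrow> Re (\<Sum>s\<in>S. of_real (c s) * (of_real (foldr lat_diff (L s) g (\<lambda>_. 0)) / \<i> ^ length (L s)))"
    by (intro tendsto_intros spec_avg_sin_tendsto)
  also have "Re (\<Sum>s\<in>S. of_real (c s) * (of_real (foldr lat_diff (L s) g (\<lambda>_. 0)) / \<i> ^ length (L s)))
     = (-1)^m * (\<Sum>s\<in>S. c s * foldr lat_diff (L s) g (\<lambda>_. 0))"
  proof -
    have "(\<Sum>s\<in>S. of_real (c s) * (of_real (foldr lat_diff (L s) g (\<lambda>_. 0)) / \<i> ^ length (L s)))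
      = complex_of_real ((-1)^m * (\<Sum>s\<in>S. c s * foldr lat_diff (L s) g (\<lambda>_. 0)))"
      unfolding sum_distrib_left of_real_sum
      by (intro sum.cong refl, cases "even m") (simp_all add: len power_mult)
    then show ?thesis by (simp only: Re_complex_of_real)
  qed
  finally have lim: "(\<lambda>N. Re (\<Sum>s\<in>S. of_real (c s) * ?T N s)) \<longlonglongrightarrow> (-1)^m * (\<Sum>s\<in>S. c s * foldr lat_diff (L s) g (\<lambda>_. 0))" .
  show ?thesis
  proof (rule tendsto_lowerbound[OF lim])
    show "\<forall>\<^sub>F N in sequentially. 0 \<le> Re (\<Sum>s\<in>S. of_real (c s) * ?T N s)"
    proof (intro always_eventually allI)
      fix N
      have lp: "(\<Prod>i\<leftarrow>M. complex_of_real (f i)) = of_real (\<Prod>i\<leftarrow>M. f i)" for M :: "'n list" and f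
        by (induction M) auto
      have "(\<Sum>s\<in>S. of_real (c s) * ?T N s)
        = (\<Sum>\<theta>\<in>freqs (3*N). of_real (\<Sum>s\<in>S. c s * (\<Prod>i\<leftarrow>L s. sin (\<theta> i))) * fejer N g \<theta>) / of_real (real (3*N) ^ CARD('n))"
        unfolding spec_avg_def lp
        by (simp add: sum_distrib_left sum_distrib_right sum_divide_distrib lat_char_def mult_ac) (rule sum.swap)
      then have "Re (\<Sum>s\<in>S. of_real (c s) * ?T N s)
        = (\<Sum>\<theta>\<in>freqs (3*N). (\<Sum>s\<in>S. c s * (\<Prod>i\<leftarrow>L s. sin (\<theta> i))) * Re (fejer N g \<theta>)) / (real (3*N) ^ CARD('n))"
        by (simp only: Re_divide_of_real Re_sum) simp
      also have "\<dots> \<ge> 0"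
        by (rule divide_nonneg_nonneg, rule sum_nonneg, rule mult_nonneg_nonneg)
           (use Re_fejer_nonneg[OF pd] nonneg in auto)
      finally show "0 \<le> Re (\<Sum>s\<in>S. of_real (c s) * ?T N s)" .
    qed
  qed simp
qed

subsection \<open>Directional derivatives\<close>

text \<open>The \<open>k\<close>-th power of \<omega> . grad, expanded over words without collecting
  equal monomials, so that partial derivatives never have to be commuted.\<close>

definition dir_deriv :: "nat \<Rightarrow> real^'n \<Rightarrow> (real^'n \<Rightarrow> real) \<Rightarrow> real^'n::finite \<Rightarrow> real" where
  "dir_deriv k \<omega> f x = (\<Sum>L | length L = k. (\<Prod>i\<leftarrow>L. \<omega> $ i) * iter_partial L f x)"

lemma finite_length_eq [simp]: "finite {L :: 'n::finite list. length L = k}"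
  using finite_lists_length_eq[of "UNIV :: 'n set" k] by simp

lemma sum_length_Suc:
  fixes F :: "'n::finite list \<Rightarrow> 'b::comm_monoid_add"
  shows "(\<Sum>L | length L = Suc k. F L) = (\<Sum>L | length L = k. \<Sum>i\<in>UNIV. F (i # L))"
proof -
  have "(\<Sum>L | length L = Suc k. F L) = (\<Sum>(L, i) \<in> {L. length L = k} \<times> UNIV. F (i # L))"
    by (rule sum.reindex_bij_witness[of _ "\<lambda>(L, i). i # L" "\<lambda>L. (tl L, hd L)"])
       (auto simp: length_Suc_conv)
  then show ?thesis by (simp add: sum.cartesian_product)
qed

text \<open>The expansion over words on the side of symbols, matching that of
  \<open>dir_deriv\<close>.\<close>

lemma inner_power_eq_sum:
  fixes x y :: "real^'n::finite"
  shows "(x \<bullet> y) ^ k = (\<Sum>L | length L = k. (\<Prod>i\<leftarrow>L. x $ i) * (\<Prod>i\<leftarrow>L. y $ i))"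
proof (induction k)
  case (Suc k)
  have "(x \<bullet> y) ^ Suc k = (\<Sum>i\<in>UNIV. x $ i * y $ i) * (\<Sum>L | length L = k. (\<Prod>i\<leftarrow>L. x $ i) * (\<Prod>i\<leftarrow>L. y $ i))"
    by (simp only: power_Suc Suc) (simp only: inner_vec_def inner_real_def)
  also have "\<dots> = (\<Sum>L | length L = Suc k. (\<Prod>i\<leftarrow>L. x $ i) * (\<Prod>i\<leftarrow>L. y $ i))"
    unfolding sum_length_Suc sum_product by (subst sum.swap) (simp add: mult_ac)
  finally show ?case .
qed simp

lemma iter_partial_Cons: "iter_partial (i # L) f = partial_d i (iter_partial L f)"
  by (simp add: iter_partial_def)

lemma iter_partial_snoc: "iter_partial (L @ [i]) f = iter_partial L (partial_d i f)"
  by (simp add: iter_partial_def)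

lemma smooth_fun_partial: "smooth_fun f \<Longrightarrow> smooth_fun (partial_d i f)"
  unfolding smooth_fun_def by (simp flip: iter_partial_snoc)

lemma smooth_fun_differentiable:
  assumes "smooth_fun f"
  shows "f differentiable (at x)"
proof -
  have "iter_partial [] f differentiable_on UNIV"
    using assms unfolding smooth_fun_def by blast
  then show ?thesis by (simp add: differentiable_on_def iter_partial_def)
qed

lemma smooth_fun_iter: "smooth_fun f \<Longrightarrow> smooth_fun (iter_partial L f)"
  by (induction L) (auto simp: iter_partial_Cons smooth_fun_partial iter_partial_def)

lemma smooth_fun_continuous: "smooth_fun f \<Longrightarrow> continuous_on S f"
  using smooth_fun_differentiable differentiable_imp_continuous_within continuous_at_imp_continuous_on by blast

lemma line_derivative:
  fixes f :: "real^'n::finite \<Rightarrow> real"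
  assumes "f differentiable (at (x + t *\<^sub>R \<omega>))"
  shows "((\<lambda>t. f (x + t *\<^sub>R \<omega>)) has_real_derivative (\<Sum>i\<in>UNIV. \<omega> $ i * partial_d i f (x + t *\<^sub>R \<omega>))) (at t)"
proof -
  obtain f' where f': "(f has_derivative f') (at (x + t *\<^sub>R \<omega>))"
    using assms unfolding differentiable_def by blast
  then interpret f': bounded_linear f' by (rule has_derivative_bounded_linear)
  \<comment> \<open>One chain rule for all lines through the point; it serves the coordinate
    directions as well as \<omega>.\<close>
  have line: "((\<lambda>s. f (y + s *\<^sub>R v)) has_real_derivative f' v) (at r)" if "y + r *\<^sub>R v = x + t *\<^sub>R \<omega>" for y v r
  proof -
    have "((\<lambda>s. y + s *\<^sub>R v) has_derivative (\<lambda>s. s *\<^sub>R v)) (at r)"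
      by (auto intro!: derivative_eq_intros)
    from has_derivative_compose[OF this] f' that
    have "((\<lambda>s. f (y + s *\<^sub>R v)) has_derivative (\<lambda>s. f' (s *\<^sub>R v))) (at r)" by auto
    moreover have "(\<lambda>s. f' (s *\<^sub>R v)) = (*) (f' v)" by (auto simp: f'.scaleR)
    ultimately show ?thesis by (simp add: has_field_derivative_def)
  qed
  have "partial_d i f (x + t *\<^sub>R \<omega>) = f' (axis i 1)" for i
    unfolding partial_d_def by (rule DERIV_imp_deriv, rule line) simp
  moreover have "f' \<omega> = (\<Sum>i\<in>UNIV. \<omega> $ i * f' (axis i 1))"
  proof -
    have "\<omega> = (\<Sum>i\<in>UNIV. \<omega> $ i *\<^sub>R axis i 1)"
      using basis_expansion[of \<omega>] by (simp add: scalar_mult_eq_scaleR)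
    then have "f' \<omega> = f' (\<Sum>i\<in>UNIV. \<omega> $ i *\<^sub>R axis i 1)" by simp
    then show ?thesis by (simp add: f'.sum f'.scaleR)
  qed
  ultimately show ?thesis using line[of x t \<omega>] by simp
qed

lemma dir_deriv_line:
  assumes "smooth_fun f"
  shows "((\<lambda>t. dir_deriv k \<omega> f (x + t *\<^sub>R \<omega>)) has_real_derivative dir_deriv (Suc k) \<omega> f (x + t *\<^sub>R \<omega>)) (at t)"
proof -
  have "((\<lambda>t. dir_deriv k \<omega> f (x + t *\<^sub>R \<omega>)) has_real_derivative
     (\<Sum>L | length L = k. (\<Prod>i\<leftarrow>L. \<omega> $ i) * (\<Sum>i\<in>UNIV. \<omega> $ i * partial_d i (iter_partial L f) (x + t *\<^sub>R \<omega>)))) (at t)"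
    unfolding dir_deriv_def
    by (intro DERIV_sum DERIV_cmult line_derivative smooth_fun_differentiable smooth_fun_iter assms)
  then show ?thesis
    by (simp add: dir_deriv_def sum_length_Suc iter_partial_Cons sum_distrib_left mult_ac)
qed

lemma dir_deriv_0 [simp]: "dir_deriv 0 \<omega> f = f"
  by (simp add: dir_deriv_def iter_partial_def fun_eq_iff)

lemma continuous_on_dir_deriv: "smooth_fun f \<Longrightarrow> continuous_on S (dir_deriv k \<omega> f)"
  unfolding dir_deriv_def by (intro continuous_intros smooth_fun_continuous smooth_fun_iter)

text \<open>The complement of \<open>K\<close> is open, so near a point outside \<open>K\<close> the
  function vanishes identically along every axis.\<close>

lemma iter_partial_eq_0:
  assumes "closed K" "\<And>x. x \<notin> K \<Longrightarrow> f x = 0" "x \<notin> K"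
  shows "iter_partial L f x = 0"
  using assms(3)
proof (induction L arbitrary: x)
  case Nil
  then show ?case using assms(2) by (simp add: iter_partial_def)
next
  case (Cons i L)
  have "isCont (\<lambda>t. x + t *\<^sub>R axis i (1::real)) 0" by (intro continuous_intros)
  then have "((\<lambda>t. x + t *\<^sub>R axis i 1) \<longlongrightarrow> x) (nhds (0::real))"
    using tendsto_at_iff_tendsto_nhds[of "\<lambda>t. x + t *\<^sub>R axis i (1::real)" "0::real"] by (simp add: isCont_def)
  then have "\<forall>\<^sub>F t in nhds 0. x + t *\<^sub>R axis i 1 \<in> - K"
    using assms(1) Cons.prems by (intro topological_tendstoD) auto
  then have "\<forall>\<^sub>F t in nhds 0. iter_partial L f (x + t *\<^sub>R axis i 1) = 0"
    by eventually_elim (auto intro: Cons.IH)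
  then have "deriv (\<lambda>t. iter_partial L f (x + t *\<^sub>R axis i 1)) 0 = deriv (\<lambda>_. 0) 0"
    by (rule deriv_cong_ev) simp
  then show ?case by (simp add: iter_partial_Cons partial_d_def)
qed

lemma dir_deriv_eq_0:
  assumes "closed K" "\<And>x. x \<notin> K \<Longrightarrow> f x = 0" "x \<notin> K"
  shows "dir_deriv k \<omega> f x = 0"
  unfolding dir_deriv_def using iter_partial_eq_0[OF assms] by simp

section \<open>Translation invariance and integration by parts for compactly supported
  functions\<close>

lemma integrable_compact_support:
  fixes f :: "'a::euclidean_space \<Rightarrow> real"
  assumes "continuous_on UNIV f" "compact K" "\<And>x. x \<notin> K \<Longrightarrow> f x = 0"
  shows "integrable lborel f"
proof -
  have "integrable lborel (\<lambda>x. indicator K x *\<^sub>R f x)"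
    using assms by (intro borel_integrable_compact) (auto intro: continuous_on_subset)
  also have "(\<lambda>x. indicator K x *\<^sub>R f x) = f"
    using assms(3) by (auto simp: indicator_def fun_eq_iff)
  finally show ?thesis .
qed

lemma bounded_compact_support:
  fixes f :: "'a::euclidean_space \<Rightarrow> real"
  assumes "continuous_on UNIV f" "compact K" "\<And>x. x \<notin> K \<Longrightarrow> f x = 0"
  obtains C where "C \<ge> 0" "\<And>x. \<bar>f x\<bar> \<le> C"
proof -
  have "bounded (f ` K)"
    using assms by (intro compact_imp_bounded compact_continuous_image) (auto intro: continuous_on_subset)
  then obtain C where C: "\<And>x. x \<in> K \<Longrightarrow> \<bar>f x\<bar> \<le> C" by (auto simp: bounded_iff)
  have "\<bar>f x\<bar> \<le> max C 0" for x
    by (cases "x \<in> K") (use C[of x] assms(3)[of x] in auto)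
  then show ?thesis by (intro that[of "max C 0"]) auto
qed

lemma lborel_integral_shift:
  fixes f :: "'a::euclidean_space \<Rightarrow> real"
  assumes [measurable]: "f \<in> borel_measurable borel"
  shows "(\<integral>x. f (x + a) \<partial>lborel) = (\<integral>x. f x \<partial>lborel)"
proof -
  have "(\<integral>x. f x \<partial>lborel) = (\<integral>x. f x \<partial>(distr lborel borel ((+) a)))"
    by (simp add: lborel_distr_plus)
  also have "\<dots> = (\<integral>x. f (a + x) \<partial>lborel)"
    by (rule integral_distr) auto
  finally show ?thesis by (simp add: add.commute)
qed

lemma nn_integral_lborel_shift:
  fixes f :: "'a::euclidean_space \<Rightarrow> ennreal"
  assumes [measurable]: "f \<in> borel_measurable borel"
  shows "(\<integral>\<^sup>+x. f (x + a) \<partial>lborel) = (\<integral>\<^sup>+x. f x \<partial>lborel)"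
proof -
  have "(\<integral>\<^sup>+x. f x \<partial>lborel) = (\<integral>\<^sup>+x. f x \<partial>(distr lborel borel ((+) a)))"
    by (simp add: lborel_distr_plus)
  also have "\<dots> = (\<integral>\<^sup>+x. f (a + x) \<partial>lborel)"
    by (rule nn_integral_distr) auto
  finally show ?thesis by (simp add: add.commute)
qed

lemma borel_measurable_UNIV: "continuous_on UNIV f \<Longrightarrow> f \<in> borel_measurable borel"
  by (rule borel_measurable_continuous_onI)

text \<open>The difference quotients of \<open>p\<close> have integral 0 by translation invariance,
  and they converge to \<open>p'\<close> under a common bound. No coordinates adapted to \<omega>
  are needed.\<close>

lemma integral_line_derivative_eq_0:
  fixes p p' :: "real^'n::finite \<Rightarrow> real"
  assumes p: "continuous_on UNIV p" "\<And>x. x \<notin> K \<Longrightarrow> p x = 0"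
    and p': "continuous_on UNIV p'" "\<And>x. x \<notin> K \<Longrightarrow> p' x = 0"
    and K: "compact K"
    and der: "\<And>x t. ((\<lambda>t. p (x + t *\<^sub>R \<omega>)) has_real_derivative p' (x + t *\<^sub>R \<omega>)) (at t)"
  shows "(\<integral>x. p' x \<partial>lborel) = 0"
proof -
  define h where "h = (\<lambda>n. 1 / real (Suc n))"
  have h: "0 < h n" "h n \<le> 1" for n by (auto simp: h_def)
  define q where "q = (\<lambda>n x. (p (x + h n *\<^sub>R \<omega>) - p x) / h n)"
  \<comment> \<open>Since the steps are at most 1, this compact set carries all the quotients: by
    the mean value theorem each is a value of \<open>p'\<close> at some x + z \<omega> with z
    between 0 and 1.\<close>
  define K' where "K' = (\<lambda>(x, t). x - t *\<^sub>R \<omega>) ` (K \<times> {0..1::real})"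
  have K': "compact K'"
    unfolding K'_def using K by (intro compact_continuous_image compact_Times) (auto intro!: continuous_intros simp: split_def)
  obtain C where C: "C \<ge> 0" "\<And>x. \<bar>p' x\<bar> \<le> C"
    using bounded_compact_support[OF p'(1) K p'(2)] by blast
  have ints: "integrable lborel (\<lambda>x. p (x + a))" for a
  proof (rule integrable_compact_support)
    show "continuous_on UNIV (\<lambda>x. p (x + a))"
      by (rule continuous_on_compose2[OF p(1)]) (auto intro!: continuous_intros)
    show "compact ((\<lambda>x. x - a) ` K)" using K by (intro compact_continuous_image continuous_intros)
    show "p (x + a) = 0" if "x \<notin> (\<lambda>x. x - a) ` K" for x
      using p(2)[of "x + a"] that by (auto simp: image_iff) (metis add_diff_cancel_right')
  qed
  have "(\<lambda>n. \<integral>x. q n x \<partial>lborel) \<longlonglongrightarrow> (\<integral>x. p' x \<partial>lborel)"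
  proof (rule integral_dominated_convergence)
    show "p' \<in> borel_measurable lborel" using borel_measurable_UNIV[OF p'(1)] by simp
    have "continuous_on UNIV (q n)" for n
      unfolding q_def using h[of n] by (auto intro!: continuous_intros continuous_on_compose2[OF p(1)])
    from borel_measurable_UNIV[OF this] show "q n \<in> borel_measurable lborel" for n by simp
    show "integrable lborel (\<lambda>x. C * indicator K' x)"
      using borel_compact[OF K'] emeasure_compact_finite[OF K']
      by (intro integrable_mult_right integrable_real_indicator) auto
    show "AE x in lborel. (\<lambda>n. q n x) \<longlonglongrightarrow> p' x"
    proof (intro AE_I2)
      fix x
      have "((\<lambda>t. (p (x + t *\<^sub>R \<omega>) - p x) / t) \<longlongrightarrow> p' x) (at 0)"
        using der[of x 0] by (simp add: has_field_derivative_iff)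
      moreover have "filterlim h (at 0) sequentially"
        unfolding filterlim_at using h LIMSEQ_inverse_real_of_nat
        by (auto simp: h_def inverse_eq_divide)
      ultimately show "(\<lambda>n. q n x) \<longlonglongrightarrow> p' x"
        unfolding q_def by (rule filterlim_compose)
    qed
    show "AE x in lborel. norm (q n x) \<le> C * indicator K' x" for n
    proof (intro AE_I2)
      fix x
      obtain z where z: "0 < z" "z < h n" "p (x + h n *\<^sub>R \<omega>) - p (x + 0 *\<^sub>R \<omega>) = (h n - 0) * p' (x + z *\<^sub>R \<omega>)"
        using MVT2[OF h(1)[of n], of "\<lambda>t. p (x + t *\<^sub>R \<omega>)" "\<lambda>t. p' (x + t *\<^sub>R \<omega>)"] der by blast
      then have q: "q n x = p' (x + z *\<^sub>R \<omega>)" using h[of n] by (simp add: q_def)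
      show "norm (q n x) \<le> C * indicator K' x"
      proof (cases "x + z *\<^sub>R \<omega> \<in> K")
        case True
        have "x = (\<lambda>(x, t). x - t *\<^sub>R \<omega>) (x + z *\<^sub>R \<omega>, z)" by simp
        moreover have "(x + z *\<^sub>R \<omega>, z) \<in> K \<times> {0..1}" using True z h(2)[of n] by auto
        ultimately have "x \<in> K'" unfolding K'_def by (rule image_eqI)
        then show ?thesis using C q by simp
      next
        case False
        then show ?thesis using C q p'(2) by simp
      qed
    qed
  qed
  moreover have "(\<integral>x. q n x \<partial>lborel) = 0" for n
  proof -
    have "(\<integral>x. q n x \<partial>lborel) = ((\<integral>x. p (x + h n *\<^sub>R \<omega>) \<partial>lborel) - (\<integral>x. p x \<partial>lborel)) / h n"
      unfolding q_def using ints ints[of 0] by simp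
    then show ?thesis using borel_measurable_UNIV[OF p(1)] by (simp add: lborel_integral_shift)
  qed
  ultimately show ?thesis by (simp add: LIMSEQ_const_iff)
qed

text \<open>Each of the \<open>k\<close> integrations by parts moves one derivative to the other
  factor and costs a sign; the line derivative of the product integrates to 0.\<close>

lemma integral_dir_deriv_shift:
  fixes u :: "real^'n::finite \<Rightarrow> real"
  assumes u: "smooth_fun u" and K: "compact K" "\<And>x. x \<notin> K \<Longrightarrow> u x = 0"
  shows "(\<integral>x. dir_deriv i \<omega> u x * dir_deriv (j + k) \<omega> u x \<partial>lborel)
     = (-1)^k * (\<integral>x. dir_deriv (i + k) \<omega> u x * dir_deriv j \<omega> u x \<partial>lborel)"
proof (induction k arbitrary: i)
  case (Suc k)
  let ?D = "\<lambda>k. dir_deriv k \<omega> u"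
  have c: "continuous_on UNIV (?D k)" for k by (rule continuous_on_dir_deriv[OF u])
  have z: "?D k x = 0" if "x \<notin> K" for k x
    using K that by (intro dir_deriv_eq_0[of K u]) (auto intro: compact_imp_closed)
  have int: "integrable lborel (\<lambda>x. ?D a x * ?D b x)" for a b
    by (rule integrable_compact_support[of _ K]) (auto intro!: continuous_intros c K z)
  have "(\<integral>x. ?D (Suc i) x * ?D (j + k) x + ?D i x * ?D (Suc (j + k)) x \<partial>lborel) = 0"
  proof (rule integral_line_derivative_eq_0[of "\<lambda>x. ?D i x * ?D (j + k) x" K _ \<omega>])
    show "((\<lambda>t. ?D i (x + t *\<^sub>R \<omega>) * ?D (j + k) (x + t *\<^sub>R \<omega>)) has_real_derivative
      ?D (Suc i) (x + t *\<^sub>R \<omega>) * ?D (j + k) (x + t *\<^sub>R \<omega>) + ?D i (x + t *\<^sub>R \<omega>) * ?D (Suc (j + k)) (x + t *\<^sub>R \<omega>)) (at t)" for x t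
      using DERIV_mult[OF dir_deriv_line[OF u, of i \<omega> x t] dir_deriv_line[OF u, of "j + k" \<omega> x t]] by (simp add: algebra_simps)
  qed (use z in \<open>auto intro!: continuous_intros c K\<close>)
  then have "(\<integral>x. ?D i x * ?D (Suc (j + k)) x \<partial>lborel) = - (\<integral>x. ?D (Suc i) x * ?D (j + k) x \<partial>lborel)"
    using int by simp
  also have "\<dots> = (-1) ^ Suc k * (\<integral>x. ?D (Suc i + k) x * ?D j x \<partial>lborel)"
    unfolding Suc.IH by simp
  finally show ?case by simp
qed simp

subsection \<open>Nonnegative symbols and quadratic forms\<close>

text \<open>Not divided by \<open>h\<close>, so that along the lattice of step \<open>h\<close> it
  is exactly \<open>lat_diff\<close>; the powers of \<open>h\<close> are divided out only before the
  limit.\<close>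

definition cdiff :: "real \<Rightarrow> 'n \<Rightarrow> (real^'n \<Rightarrow> real) \<Rightarrow> real^'n::finite \<Rightarrow> real" where
  "cdiff h i f x = (f (x + h *\<^sub>R axis i 1) - f (x - h *\<^sub>R axis i 1)) / 2"

lemma continuous_on_cdiff:
  "continuous_on UNIV f \<Longrightarrow> continuous_on UNIV (foldr (cdiff h) L f)"
proof (induction L)
  case (Cons i L)
  define F where "F = foldr (cdiff h) L f"
  have F: "continuous_on UNIV F" using Cons by (simp add: F_def)
  have "foldr (cdiff h) (i # L) f = (\<lambda>x. (F (x + h *\<^sub>R axis i 1) - F (x - h *\<^sub>R axis i 1)) / 2)"
    by (simp add: F_def cdiff_def fun_eq_iff)
  moreover have "continuous_on UNIV (\<lambda>x. (F (x + h *\<^sub>R axis i 1) - F (x - h *\<^sub>R axis i 1)) / 2)"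
    by (intro continuous_intros continuous_on_compose2[OF F]) auto
  ultimately show ?case by simp
qed simp

text \<open>The two conjuncts need each other in the induction: the mean value theorem is applied to the
  difference quotient of the tail, whose derivative is the same quotient of a partial derivative. The
  reversal of the list avoids any appeal to the symmetry of mixed partial derivatives.\<close>

lemma foldr_cdiff_mvt:
  fixes f :: "real^'n::finite \<Rightarrow> real"
  assumes "smooth_fun f" "h > 0"
  shows "(\<forall>x. \<exists>y. norm (y - x) \<le> real (length L) * h \<and>
      foldr (cdiff h) L f x = h ^ length L * iter_partial (rev L) f y)
    \<and> (\<forall>x i t. ((\<lambda>t. foldr (cdiff h) L f (x + t *\<^sub>R axis i 1)) has_real_derivative
           foldr (cdiff h) L (partial_d i f) (x + t *\<^sub>R axis i 1)) (at t))"
  using assms(1)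
proof (induction L arbitrary: f)
  case Nil
  have axis_sum: "(\<Sum>j\<in>UNIV. axis i 1 $ j * g j) = g i" for i :: 'n and g :: "'n \<Rightarrow> real"
    by (simp add: axis_def if_distrib[of "\<lambda>a. a * _"] cong: if_cong)
  have "((\<lambda>t. f (x + t *\<^sub>R axis i 1)) has_real_derivative partial_d i f (x + t *\<^sub>R axis i 1)) (at t)" for x i t
    using line_derivative[OF smooth_fun_differentiable[OF Nil], of x "axis i 1" t]
    by (simp only: axis_sum)
  moreover have "\<exists>y. norm (y - x) \<le> 0 \<and> f x = f y" for x
    by (intro exI[of _ x]) simp
  ultimately show ?case by (simp add: iter_partial_def)
next
  case (Cons j L)
  let ?F = "foldr (cdiff h) L f"
  have der: "((\<lambda>t. ?F (x + t *\<^sub>R axis i 1)) has_real_derivative foldr (cdiff h) L (partial_d i f) (x + t *\<^sub>R axis i 1)) (at t)" for x i t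
    using Cons.IH[OF Cons.prems] by blast
  show ?case
  proof (intro conjI allI)
    fix x
    obtain z where z: "-h < z" "z < h" "?F (x + h *\<^sub>R axis j 1) - ?F (x + (-h) *\<^sub>R axis j 1) = (h - (-h)) * foldr (cdiff h) L (partial_d j f) (x + z *\<^sub>R axis j 1)"
      using MVT2[of "-h" h "\<lambda>t. ?F (x + t *\<^sub>R axis j 1)" "\<lambda>t. foldr (cdiff h) L (partial_d j f) (x + t *\<^sub>R axis j 1)"] der \<open>h > 0\<close> by auto
    obtain y where y: "norm (y - (x + z *\<^sub>R axis j 1)) \<le> real (length L) * h"
      "foldr (cdiff h) L (partial_d j f) (x + z *\<^sub>R axis j 1) = h ^ length L * iter_partial (rev L) (partial_d j f) y"
      using Cons.IH[OF smooth_fun_partial[OF Cons.prems, of j]] by blast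
    have "norm (y - x) \<le> norm (y - (x + z *\<^sub>R axis j 1)) + norm (z *\<^sub>R axis j (1::real))"
      using norm_triangle_ineq[of "y - (x + z *\<^sub>R axis j 1)" "z *\<^sub>R axis j 1"] by simp
    also have "norm (z *\<^sub>R axis j (1::real)) \<le> h" using z by simp
    finally have "norm (y - x) \<le> real (length (j # L)) * h" using y by (simp add: algebra_simps)
    moreover have "foldr (cdiff h) (j # L) f x = h ^ length (j # L) * iter_partial (rev (j # L)) f y"
      using z(3) y(2) by (simp add: cdiff_def iter_partial_snoc)
    ultimately show "\<exists>y. norm (y - x) \<le> real (length (j # L)) * h \<and>
      foldr (cdiff h) (j # L) f x = h ^ length (j # L) * iter_partial (rev (j # L)) f y" by blast
  next
    fix x i t
    have "((\<lambda>t. ?F ((x + a *\<^sub>R axis j 1) + t *\<^sub>R axis i 1)) has_real_derivative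
       foldr (cdiff h) L (partial_d i f) ((x + a *\<^sub>R axis j 1) + t *\<^sub>R axis i 1)) (at t)" for a
      by (rule der)
    from DERIV_cdivide[OF DERIV_diff[OF this[of h] this[of "-h"]], of 2]
    show "((\<lambda>t. foldr (cdiff h) (j # L) f (x + t *\<^sub>R axis i 1)) has_real_derivative
           foldr (cdiff h) (j # L) (partial_d i f) (x + t *\<^sub>R axis i 1)) (at t)"
      by (simp add: cdiff_def algebra_simps)
  qed
qed

section \<open>Autocorrelations sampled on a scaled lattice\<close>

definition lat_vec :: "('n::finite \<Rightarrow> int) \<Rightarrow> real^'n" where
  "lat_vec k = (\<chi> i. of_int (k i))"

lemma lat_vec_simps:
  "lat_vec (\<lambda>i. k i + l i) = lat_vec k + lat_vec l"
  "lat_vec (\<lambda>i. k i - l i) = lat_vec k - lat_vec l"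
  "lat_vec (lat_axis i) = axis i 1"
  "lat_vec (\<lambda>_. 0) = 0"
  by (simp_all add: lat_vec_def lat_axis_def axis_def vec_eq_iff)

lemma integrable_mult_shift:
  fixes u f :: "real^'n::finite \<Rightarrow> real"
  assumes "continuous_on UNIV u" "compact K" "\<And>x. x \<notin> K \<Longrightarrow> u x = 0" "continuous_on UNIV f"
  shows "integrable lborel (\<lambda>x. u (x + b) * f (x + a))"
proof (rule integrable_compact_support)
  show "continuous_on UNIV (\<lambda>x. u (x + b) * f (x + a))"
    by (intro continuous_intros continuous_on_compose2[OF assms(1)] continuous_on_compose2[OF assms(4)]) auto
  show "compact ((\<lambda>x. x - b) ` K)" using assms by (intro compact_continuous_image continuous_intros)
  show "u (x + b) * f (x + a) = 0" if "x \<notin> (\<lambda>x. x - b) ` K" for x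
    using assms(3)[of "x + b"] that by (auto simp: image_iff) (metis add_diff_cancel_right')
qed

text \<open>The correlation is linear in the shifted factor, so differences in the shift pass under
  the integral onto \<open>f\<close>.\<close>

lemma foldr_lat_diff_integral:
  fixes u f :: "real^'n::finite \<Rightarrow> real"
  assumes u: "continuous_on UNIV u" "compact K" "\<And>x. x \<notin> K \<Longrightarrow> u x = 0" and f: "continuous_on UNIV f"
  shows "foldr lat_diff L (\<lambda>k. \<integral>x. u x * f (x + h *\<^sub>R lat_vec k) \<partial>lborel) k
     = (\<integral>x. u x * foldr (cdiff h) L f (x + h *\<^sub>R lat_vec k) \<partial>lborel)"
proof (induction L arbitrary: k)
  case (Cons i L)
  have int: "integrable lborel (\<lambda>x. u x * foldr (cdiff h) L f (x + a))" for a
    using integrable_mult_shift[OF u continuous_on_cdiff[OF f], of 0] by simp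
  have "foldr lat_diff (i # L) (\<lambda>k. \<integral>x. u x * f (x + h *\<^sub>R lat_vec k) \<partial>lborel) k
    = ((\<integral>x. u x * foldr (cdiff h) L f (x + h *\<^sub>R (lat_vec k + axis i 1)) \<partial>lborel)
      - (\<integral>x. u x * foldr (cdiff h) L f (x + h *\<^sub>R (lat_vec k - axis i 1)) \<partial>lborel)) / 2"
    by (simp add: lat_diff_def Cons.IH lat_vec_simps)
  also have "\<dots> = (\<integral>x. (u x * foldr (cdiff h) L f (x + h *\<^sub>R (lat_vec k + axis i 1))
      - u x * foldr (cdiff h) L f (x + h *\<^sub>R (lat_vec k - axis i 1))) / 2 \<partial>lborel)"
    using int by simp
  also have "\<dots> = (\<integral>x. u x * foldr (cdiff h) (i # L) f (x + h *\<^sub>R lat_vec k) \<partial>lborel)"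
    by (intro Bochner_Integration.integral_cong refl) (simp add: cdiff_def algebra_simps diff_divide_distrib)
  finally show ?case .
qed simp

text \<open>By translation invariance the value at j - l is the inner product of two translates of
  \<open>u\<close>, so the form is the integral of the square of a combination of
  translates.\<close>

lemma pos_def_autocorrelation:
  fixes u :: "real^'n::finite \<Rightarrow> real"
  assumes u: "continuous_on UNIV u" "compact K" "\<And>x. x \<notin> K \<Longrightarrow> u x = 0"
  shows "pos_def_lat (\<lambda>k. \<integral>x. u x * u (x + h *\<^sub>R lat_vec k) \<partial>lborel)"
  unfolding pos_def_lat_def
proof (intro allI impI)
  fix J :: "('n \<Rightarrow> int) set" and w :: "('n \<Rightarrow> int) \<Rightarrow> real" assume "finite J"
  let ?v = "\<lambda>j x. u (x + h *\<^sub>R lat_vec j)"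
  have int: "integrable lborel (\<lambda>x. ?v l x * ?v j x)" for l j
    by (rule integrable_mult_shift[OF u u(1)])
  have shift: "(\<integral>x. u x * u (x + h *\<^sub>R lat_vec (\<lambda>i. j i - l i)) \<partial>lborel) = (\<integral>x. ?v l x * ?v j x \<partial>lborel)" for j l
  proof -
    have "continuous_on UNIV (\<lambda>x. u x * u (x + h *\<^sub>R lat_vec (\<lambda>i. j i - l i)))"
      by (intro continuous_intros continuous_on_compose2[OF u(1)] u) auto
    from lborel_integral_shift[OF borel_measurable_UNIV[OF this], of "h *\<^sub>R lat_vec l"]
    show ?thesis by (simp add: lat_vec_simps algebra_simps)
  qed
  have "(\<Sum>j\<in>J. \<Sum>l\<in>J. w j * w l * (\<integral>x. u x * u (x + h *\<^sub>R lat_vec (\<lambda>i. j i - l i)) \<partial>lborel))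
     = (\<integral>x. (\<Sum>j\<in>J. \<Sum>l\<in>J. w j * w l * (?v l x * ?v j x)) \<partial>lborel)"
    using int by (simp add: shift)
  also have "\<dots> = (\<integral>x. (\<Sum>j\<in>J. w j * ?v j x)^2 \<partial>lborel)"
    by (intro Bochner_Integration.integral_cong refl) (simp add: power2_eq_square sum_product mult_ac)
  also have "\<dots> \<ge> 0" by simp
  finally show "0 \<le> (\<Sum>j\<in>J. \<Sum>l\<in>J. w j * w l * (\<integral>x. u x * u (x + h *\<^sub>R lat_vec (\<lambda>i. j i - l i)) \<partial>lborel))" .
qed

text \<open>Every difference quotient is a derivative taken at a point that approaches
  \<open>x\<close> with \<open>h\<close>; a bound \<open>C\<close> on that derivative gives the
  dominating function \<open>C\<close> times the absolute value of \<open>u\<close>. The word is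
  reversed as in the mean value lemma.\<close>

lemma cdiff_integral_tendsto:
  fixes u :: "real^'n::finite \<Rightarrow> real"
  assumes u: "smooth_fun u" and K: "compact K" "\<And>x. x \<notin> K \<Longrightarrow> u x = 0"
    and h: "\<And>n. h n > 0" "h \<longlonglongrightarrow> 0"
  shows "(\<lambda>n. (\<integral>x. u x * foldr (cdiff (h n)) L u x \<partial>lborel) / h n ^ length L)
     \<longlonglongrightarrow> (\<integral>x. u x * iter_partial (rev L) u x \<partial>lborel)"
proof -
  let ?D = "iter_partial (rev L) u"
  have cu: "continuous_on UNIV u" and cD: "continuous_on UNIV ?D"
    using u by (auto intro: smooth_fun_continuous smooth_fun_iter)
  have "?D x = 0" if "x \<notin> K" for x
    using iter_partial_eq_0[OF compact_imp_closed[OF K(1)] K(2) that] .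
  then obtain C where C: "C \<ge> 0" "\<And>x. \<bar>?D x\<bar> \<le> C"
    using bounded_compact_support[OF cD K(1)] by blast
  have "\<exists>y. norm (y - x) \<le> real (length L) * h n \<and> foldr (cdiff (h n)) L u x = h n ^ length L * ?D y" for x n
    using foldr_cdiff_mvt[OF u h(1)] by blast
  then obtain y where y: "\<And>x n. norm (y x n - x) \<le> real (length L) * h n"
    "\<And>x n. foldr (cdiff (h n)) L u x = h n ^ length L * ?D (y x n)" by metis
  have eq: "u x * foldr (cdiff (h n)) L u x / h n ^ length L = u x * ?D (y x n)" for x n
    using h(1)[of n] y(2) by simp
  have "(\<lambda>n. \<integral>x. u x * foldr (cdiff (h n)) L u x / h n ^ length L \<partial>lborel) \<longlonglongrightarrow> (\<integral>x. u x * ?D x \<partial>lborel)"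
  proof (rule integral_dominated_convergence)
    show "(\<lambda>x. u x * ?D x) \<in> borel_measurable lborel"
      using borel_measurable_UNIV[OF continuous_on_mult[OF cu cD]] by simp
    have "continuous_on UNIV (\<lambda>x. u x * foldr (cdiff (h n)) L u x / h n ^ length L)" for n
      using h(1)[of n] by (intro continuous_intros cu continuous_on_cdiff) auto
    from borel_measurable_UNIV[OF this] show "(\<lambda>x. u x * foldr (cdiff (h n)) L u x / h n ^ length L) \<in> borel_measurable lborel" for n
      by simp
    show "integrable lborel (\<lambda>x. \<bar>u x\<bar> * C)"
      using K by (intro integrable_compact_support[of _ K]) (auto intro!: continuous_intros cu)
    show "AE x in lborel. norm (u x * foldr (cdiff (h n)) L u x / h n ^ length L) \<le> \<bar>u x\<bar> * C" for n
      unfolding eq using C by (auto simp: abs_mult intro!: mult_left_mono)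
    show "AE x in lborel. (\<lambda>n. u x * foldr (cdiff (h n)) L u x / h n ^ length L) \<longlonglongrightarrow> u x * ?D x"
    proof (intro AE_I2)
      fix x
      have "(\<lambda>n. real (length L) * h n) \<longlonglongrightarrow> real (length L) * 0" by (intro tendsto_intros h)
      then have "(\<lambda>n. real (length L) * h n) \<longlonglongrightarrow> 0" by simp
      then have "(\<lambda>n. y x n - x) \<longlonglongrightarrow> 0"
        by (rule Lim_null_comparison[rotated]) (use y(1) in auto)
      then have "(\<lambda>n. y x n) \<longlonglongrightarrow> x" by (simp add: LIM_zero_iff)
      moreover have "isCont ?D x" using cD by (simp add: continuous_on_eq_continuous_at)
      ultimately have "(\<lambda>n. ?D (y x n)) \<longlonglongrightarrow> ?D x" by (rule isCont_tendsto_compose[rotated])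
      then show "(\<lambda>n. u x * foldr (cdiff (h n)) L u x / h n ^ length L) \<longlonglongrightarrow> u x * ?D x"
        unfolding eq by (intro tendsto_intros)
    qed
  qed
  then show ?thesis by simp
qed

text \<open>The lattice statement is applied to the autocorrelation of \<open>u\<close> on the
  lattice of step \<open>h\<close>, divided by h^(2m), and \<open>h\<close> tends to 0. This
  replaces Plancherel's theorem.\<close>

lemma quadratic_form_nonneg:
  fixes u :: "real^'n::finite \<Rightarrow> real" and c :: "'s \<Rightarrow> real" and L :: "'s \<Rightarrow> 'n list"
  assumes u: "smooth_fun u" and K: "compact K" "\<And>x. x \<notin> K \<Longrightarrow> u x = 0"
    and S: "finite S" and len: "\<And>s. s \<in> S \<Longrightarrow> length (L s) = 2 * m"
    and nonneg: "\<And>\<xi> :: 'n \<Rightarrow> real. (\<Sum>s\<in>S. c s * (\<Prod>i\<leftarrow>L s. \<xi> i)) \<ge> 0"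
  shows "(-1)^m * (\<Sum>s\<in>S. c s * (\<integral>x. u x * iter_partial (L s) u x \<partial>lborel)) \<ge> 0"
proof -
  define h where "h = (\<lambda>n. 1 / real (Suc n))"
  have h: "0 < h n" for n by (auto simp: h_def)
  have h0: "h \<longlonglongrightarrow> 0"
    using LIMSEQ_inverse_real_of_nat by (simp add: h_def inverse_eq_divide)
  have cu: "continuous_on UNIV u" using u by (rule smooth_fun_continuous)
  \<comment> \<open>The words are reversed beforehand because the limit of the differences reverses
    them again.\<close>
  have "(\<lambda>n. (-1)^m * (\<Sum>s\<in>S. c s * ((\<integral>x. u x * foldr (cdiff (h n)) (rev (L s)) u x \<partial>lborel) / h n ^ length (rev (L s)))))
    \<longlonglongrightarrow> (-1)^m * (\<Sum>s\<in>S. c s * (\<integral>x. u x * iter_partial (rev (rev (L s))) u x \<partial>lborel))"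
    by (intro tendsto_intros cdiff_integral_tendsto[of u K] u K h h0)
  then have lim: "(\<lambda>n. (-1)^m * (\<Sum>s\<in>S. c s * ((\<integral>x. u x * foldr (cdiff (h n)) (rev (L s)) u x \<partial>lborel) / h n ^ length (rev (L s)))))
    \<longlonglongrightarrow> (-1)^m * (\<Sum>s\<in>S. c s * (\<integral>x. u x * iter_partial (L s) u x \<partial>lborel))" by simp
  show ?thesis
  proof (rule tendsto_lowerbound[OF lim], intro always_eventually allI)
    fix n
    let ?g = "\<lambda>k. \<integral>x. u x * u (x + h n *\<^sub>R lat_vec k) \<partial>lborel"
    have "0 \<le> (-1)^m * (\<Sum>s\<in>S. c s * foldr lat_diff (rev (L s)) ?g (\<lambda>_. 0))"
      using len nonneg by (intro lattice_positivity pos_def_autocorrelation[OF cu K] S)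
        (auto simp: rev_map[symmetric])
    then have "0 \<le> (-1)^m * (\<Sum>s\<in>S. c s * foldr lat_diff (rev (L s)) ?g (\<lambda>_. 0)) / h n ^ (2*m)"
      using h[of n] by simp
    also have "\<dots> = (-1)^m * (\<Sum>s\<in>S. c s * ((\<integral>x. u x * foldr (cdiff (h n)) (rev (L s)) u x \<partial>lborel) / h n ^ length (rev (L s))))"
      using foldr_lat_diff_integral[OF cu K(1) _ cu, of _ "h n" "\<lambda>_. 0"] K(2)
      by (simp add: lat_vec_simps len flip: sum_divide_distrib)
    finally show "0 \<le> (-1)^m * (\<Sum>s\<in>S. c s * ((\<integral>x. u x * foldr (cdiff (h n)) (rev (L s)) u x \<partial>lborel) / h n ^ length (rev (L s))))" .
  qed simp
qed

subsection \<open>The one-dimensional Hardy-Rellich inequality\<close>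

text \<open>The derivative of G = l f^2 / (t - \<alpha>)^(2k+1) is at most the difference of the two
  integrands, and its integral G(c) - G(p) is nonnegative because \<open>f\<close> vanishes at
  \<open>p\<close>.\<close>

lemma weighted_hardy_step:
  fixes f f' :: "real \<Rightarrow> real"
  assumes "\<alpha> < p" "p \<le> c"
    and deriv: "\<And>t. (f has_real_derivative f' t) (at t)"
    and cont: "continuous_on UNIV f'"
    and "f p = 0"
  shows "((2 * real k + 1)^2 / 4) * integral {p..c} (\<lambda>t. (f t)^2 / (t - \<alpha>)^(2*k + 2))
         \<le> integral {p..c} (\<lambda>t. (f' t)^2 / (t - \<alpha>)^(2*k))"
proof -
  define l where "l = (2 * real k + 1) / 2"
  define G where "G = (\<lambda>t. l * (f t)^2 / (t - \<alpha>)^(2*k+1))"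
  define G' where "G' = (\<lambda>t. 2 * l * f t * f' t / (t - \<alpha>)^(2*k+1) - 2 * l^2 * (f t)^2 / (t - \<alpha>)^(2*k+2))"
  have contf: "continuous_on S f" for S
    using deriv by (meson DERIV_continuous_on has_field_derivative_at_within)
  have contf': "continuous_on S f'" for S
    using cont continuous_on_subset by blast
  have nz: "t - \<alpha> \<noteq> 0" if "t \<in> {p..c}" for t using that assms by auto
  have dG: "(G has_real_derivative G' t) (at t)" if "t \<in> {p..c}" for t
  proof -
    have pos: "t - \<alpha> \<noteq> 0" using nz that by auto
    have dP: "((\<lambda>t. (t - \<alpha>)^(2*k+1)) has_real_derivative real (2*k+1) * (t - \<alpha>)^(2*k)) (at t)"
      by (rule derivative_eq_intros refl)+ simp
    have dN: "((\<lambda>t. l * (f t)^2) has_real_derivative l * (2 * f t * f' t)) (at t)"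
      by (rule derivative_eq_intros deriv refl)+ simp
    have "(G has_real_derivative (l * (2 * f t * f' t) * (t - \<alpha>)^(2*k+1) - l * (f t)^2 * (real (2*k+1) * (t - \<alpha>)^(2*k))) / ((t - \<alpha>)^(2*k+1) * (t - \<alpha>)^(2*k+1))) (at t)"
      unfolding G_def using DERIV_divide[OF dN dP] pos by simp
    also have "(l * (2 * f t * f' t) * (t - \<alpha>)^(2*k+1) - l * (f t)^2 * (real (2*k+1) * (t - \<alpha>)^(2*k))) / ((t - \<alpha>)^(2*k+1) * (t - \<alpha>)^(2*k+1)) = G' t"
    proof -
      have e: "real (2*k+1) = 2 * l" by (simp add: l_def)
      define s where "s = t - \<alpha>"
      have s: "s \<noteq> 0" using pos by (simp add: s_def)
      show ?thesis unfolding G'_def e s_def[symmetric] using s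
        by (simp add: divide_simps) (simp add: algebra_simps power2_eq_square)
    qed
    finally show ?thesis .
  qed
  have "(G' has_integral (G c - G p)) {p..c}"
    using \<open>p \<le> c\<close> dG
    by (intro fundamental_theorem_of_calculus)
       (auto simp: has_real_derivative_iff_has_vector_derivative [symmetric] intro: has_field_derivative_at_within)
  then have G: "integral {p..c} G' = G c - G p" "G' integrable_on {p..c}"
    by (auto simp: integral_unique has_integral_integrable)
  have "G c - G p \<ge> 0"
    using assms by (simp add: G_def l_def)
  have i1: "(\<lambda>t. (f' t)^2 / (t - \<alpha>)^(2*k)) integrable_on {p..c}"
    using nz by (intro integrable_continuous_real continuous_intros contf') auto
  have i3: "(\<lambda>t. l^2 * ((f t)^2 / (t - \<alpha>)^(2*k+2))) integrable_on {p..c}"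
    using nz by (intro integrable_continuous_real continuous_intros contf) auto
  have "0 \<le> integral {p..c} G'" using G \<open>G c - G p \<ge> 0\<close> by simp
  also have "\<dots> \<le> integral {p..c} (\<lambda>t. (f' t)^2 / (t - \<alpha>)^(2*k) - l^2 * ((f t)^2 / (t - \<alpha>)^(2*k+2)))"
  proof (intro integral_le G integrable_diff i1 i3)
    fix t assume t: "t \<in> {p..c}"
    \<comment> \<open>completing the square; \<open>l\<close> maximises the resulting constant \<open>(2k + 1) l - l\<^sup>2\<close>\<close>
    have "(f' t)^2 / (t - \<alpha>)^(2*k) - l^2 * ((f t)^2 / (t - \<alpha>)^(2*k+2)) - G' t
       = (f' t - l * f t / (t - \<alpha>))^2 / (t - \<alpha>)^(2*k)"
    proof -
      define s where "s = t - \<alpha>"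
      have s: "s \<noteq> 0" using nz[OF t] by (simp add: s_def)
      show ?thesis unfolding G'_def s_def[symmetric] using s
        by (simp add: divide_simps) (simp add: algebra_simps power2_eq_square)
    qed
    also have "\<dots> \<ge> 0" by simp
    finally show "G' t \<le> (f' t)^2 / (t - \<alpha>)^(2*k) - l^2 * ((f t)^2 / (t - \<alpha>)^(2*k+2))"
      by simp
  qed
  also have "\<dots> = integral {p..c} (\<lambda>t. (f' t)^2 / (t - \<alpha>)^(2*k)) - l^2 * integral {p..c} (\<lambda>t. (f t)^2 / (t - \<alpha>)^(2*k+2))"
    by (simp only: Henstock_Kurzweil_Integration.integral_diff[OF i1 i3] Henstock_Kurzweil_Integration.integral_mult_right)
  finally show ?thesis by (simp add: l_def power_divide)
qed

lemma A_const_Suc: "A_const (Suc m) = A_const m * ((2 * real m + 1)^2 / 4)"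
  by (simp add: A_const_def algebra_simps)

lemma A_const_pos: "A_const m > 0"
  unfolding A_const_def by (intro divide_pos_pos prod_pos) auto

text \<open>No condition is imposed at the right end \<open>c\<close>, where the boundary term has the good sign. This is
  what allows an interval to be cut at its midpoint.\<close>

lemma hardy_left:
  fixes \<phi> :: "nat \<Rightarrow> real \<Rightarrow> real"
  assumes "\<alpha> < p" "p \<le> c"
    and "\<And>j t. (\<phi> j has_real_derivative \<phi> (Suc j) t) (at t)"
    and "\<And>j. \<phi> j p = 0"
  shows "A_const m * integral {p..c} (\<lambda>t. (\<phi> 0 t)^2 / (t - \<alpha>)^(2*m))
         \<le> integral {p..c} (\<lambda>t. (\<phi> m t)^2)"
  using assms(3,4)
proof (induction m arbitrary: \<phi>)
  case 0
  then show ?case by (simp add: A_const_def)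
next
  case (Suc m)
  have cont: "continuous_on UNIV (\<phi> j)" for j
    using Suc.prems(1) by (meson DERIV_continuous_on has_field_derivative_at_within)
  have "A_const (Suc m) * integral {p..c} (\<lambda>t. (\<phi> 0 t)^2 / (t - \<alpha>)^(2 * Suc m))
     = A_const m * (((2 * real m + 1)^2 / 4) * integral {p..c} (\<lambda>t. (\<phi> 0 t)^2 / (t - \<alpha>)^(2*m + 2)))"
    by (simp add: A_const_Suc mult.assoc)
  \<comment> \<open>One weighted step lowers the exponent by two and passes to the first derivative;
    the induction hypothesis then applies to the sequence of derivatives shifted by one.\<close>
  also have "\<dots> \<le> A_const m * integral {p..c} (\<lambda>t. (\<phi> 1 t)^2 / (t - \<alpha>)^(2*m))"
    using Suc.prems assms(1,2) cont A_const_pos[of m]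
    by (intro mult_left_mono weighted_hardy_step) auto
  also have "\<dots> \<le> integral {p..c} (\<lambda>t. (\<phi> (Suc m) t)^2)"
    using Suc.IH[of "\<lambda>j. \<phi> (Suc j)"] Suc.prems by simp
  finally show ?case .
qed

lemma hardy_right:
  fixes \<phi> :: "nat \<Rightarrow> real \<Rightarrow> real"
  assumes "c \<le> q" "q < \<beta>"
    and der: "\<And>j t. (\<phi> j has_real_derivative \<phi> (Suc j) t) (at t)"
    and "\<And>j. \<phi> j q = 0"
  shows "A_const m * integral {c..q} (\<lambda>t. (\<phi> 0 t)^2 / (\<beta> - t)^(2*m))
         \<le> integral {c..q} (\<lambda>t. (\<phi> m t)^2)"
proof -
  \<comment> \<open>Reflection of the line; the signs restore the relation that each function is the
    derivative of the one before.\<close>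
  define \<psi> where "\<psi> = (\<lambda>j t. (-1)^j * \<phi> j (-t))"
  have d: "(\<psi> j has_real_derivative \<psi> (Suc j) t) (at t)" for j t
  proof -
    have "((\<lambda>t. \<phi> j (- t)) has_real_derivative \<phi> (Suc j) (-t) * (-1)) (at t)"
      by (rule DERIV_chain2[OF der]) (auto intro!: derivative_eq_intros)
    from DERIV_cmult[OF this, of "(-1)^j"] show ?thesis by (simp add: \<psi>_def)
  qed
  have "A_const m * integral {-q..-c} (\<lambda>t. (\<psi> 0 t)^2 / (t - (-\<beta>))^(2*m))
         \<le> integral {-q..-c} (\<lambda>t. (\<psi> m t)^2)"
    using assms d by (intro hardy_left) (auto simp: \<psi>_def)
  moreover have "integral {-q..-c} (\<lambda>t. (\<psi> 0 t)^2 / (t - (-\<beta>))^(2*m)) = integral {c..q} (\<lambda>t. (\<phi> 0 t)^2 / (\<beta> - t)^(2*m))"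
    using Henstock_Kurzweil_Integration.integral_reflect_real[of q c "\<lambda>t. (\<phi> 0 t)^2 / (\<beta> - t)^(2*m)"]
    by (simp add: \<psi>_def add.commute)
  moreover have "integral {-q..-c} (\<lambda>t. (\<psi> m t)^2) = integral {c..q} (\<lambda>t. (\<phi> m t)^2)"
    using Henstock_Kurzweil_Integration.integral_reflect_real[of q c "\<lambda>t. (\<phi> m t)^2"]
    by (simp add: \<psi>_def power_mult_distrib flip: power_mult)
  ultimately show ?thesis by simp
qed

text \<open>On each half of the interval the nearer end determines the minimum, so the two one-sided
  inequalities add up. The relation between \<open>p\<close> and \<open>q\<close> places them
  symmetrically, so that the midpoint of \<alpha> and \<beta> lies between them.\<close>

lemma hardy_interval:
  fixes \<phi> :: "nat \<Rightarrow> real \<Rightarrow> real" and v :: "real \<Rightarrow> ennreal"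
  assumes ab: "\<alpha> < p" "p \<le> q" and q: "q = \<beta> - (p - \<alpha>)"
    and der: "\<And>j t. (\<phi> j has_real_derivative \<phi> (Suc j) t) (at t)"
    and out: "\<And>j t. t \<le> p \<or> q \<le> t \<Longrightarrow> \<phi> j t = 0"
    and v: "\<And>t. p < t \<Longrightarrow> t < q \<Longrightarrow> v t \<le> ennreal (1 / (min (t - \<alpha>) (\<beta> - t))^(2*m))"
  shows "(\<integral>\<^sup>+t. ennreal (A_const m * (\<phi> 0 t)^2) * v t \<partial>lborel) \<le> (\<integral>\<^sup>+t. ennreal ((\<phi> m t)^2) \<partial>lborel)"
proof -
  define c where "c = (\<alpha> + \<beta>) / 2"
  have c: "p \<le> c" "c \<le> q" "q < \<beta>" using ab q by (auto simp: c_def)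
  have cont: "continuous_on S (\<phi> j)" for j S
    using der by (meson DERIV_continuous_on has_field_derivative_at_within)
  have [measurable]: "\<phi> j \<in> borel_measurable borel" for j
    using cont by (rule borel_measurable_continuous_onI)
  have nn: "(\<integral>\<^sup>+t. ennreal (indicator {x..y} t * f t) \<partial>lborel) = ennreal (integral {x..y} f)"
    if "continuous_on {x..y} f" "\<And>t. 0 \<le> f t" "f \<in> borel_measurable borel" for x y and f :: "real \<Rightarrow> real"
  proof -
    have "(f has_integral integral {x..y} f) {x..y}"
      using that by (intro integrable_integral integrable_continuous_real)
    then have "((\<lambda>t. indicator {x..y} t * f t) has_integral integral {x..y} f) UNIV"
      using has_integral_restrict_UNIV[of "{x..y}" f] by (simp add: indicator_def of_bool_def if_distrib[of "\<lambda>a. a * _"] cong: if_cong)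
    then show ?thesis using that by (intro nn_integral_has_integral_lborel) auto
  qed
  let ?f1 = "\<lambda>t. A_const m * ((\<phi> 0 t)^2 / (t - \<alpha>)^(2*m))"
  let ?f2 = "\<lambda>t. A_const m * ((\<phi> 0 t)^2 / (\<beta> - t)^(2*m))"
  have A: "0 \<le> A_const m" using A_const_pos[of m] by simp
  have "(\<integral>\<^sup>+t. ennreal (A_const m * (\<phi> 0 t)^2) * v t \<partial>lborel)
     \<le> (\<integral>\<^sup>+t. ennreal (indicator {p..c} t * ?f1 t) + ennreal (indicator {c..q} t * ?f2 t) \<partial>lborel)"
  proof (rule nn_integral_mono)
    fix t
    show "ennreal (A_const m * (\<phi> 0 t)^2) * v t \<le> ennreal (indicator {p..c} t * ?f1 t) + ennreal (indicator {c..q} t * ?f2 t)"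
    proof (cases "p < t \<and> t < q")
      case False
      then show ?thesis using out[of t 0] by auto
    next
      case True
      have "ennreal (A_const m * (\<phi> 0 t)^2) * v t \<le> ennreal (A_const m * (\<phi> 0 t)^2) * ennreal (1 / (min (t - \<alpha>) (\<beta> - t))^(2*m))"
        using v True by (intro mult_left_mono) auto
      also have "\<dots> = ennreal (A_const m * ((\<phi> 0 t)^2 / (min (t - \<alpha>) (\<beta> - t))^(2*m)))"
        using A by (subst ennreal_mult[symmetric]) (auto simp: power_mult)
      also have "\<dots> \<le> ennreal (indicator {p..c} t * ?f1 t) + ennreal (indicator {c..q} t * ?f2 t)"
      proof (cases "t \<le> c")
        case T: True
        then have "min (t - \<alpha>) (\<beta> - t) = t - \<alpha>" by (simp add: c_def)
        then show ?thesis using T True by simp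
      next
        case F: False
        then have "min (t - \<alpha>) (\<beta> - t) = \<beta> - t" by (simp add: c_def)
        then show ?thesis using F True by simp
      qed
      finally show ?thesis .
    qed
  qed
  also have "\<dots> = ennreal (integral {p..c} ?f1) + ennreal (integral {c..q} ?f2)"
  proof (subst nn_integral_add)
    have "continuous_on {p..c} ?f1" "continuous_on {c..q} ?f2"
      using ab c by (auto intro!: continuous_intros cont)
    then show "(\<integral>\<^sup>+ x. ennreal (indicat_real {p..c} x * ?f1 x) \<partial>lborel) + (\<integral>\<^sup>+ x. ennreal (indicat_real {c..q} x * ?f2 x) \<partial>lborel) = ennreal (integral {p..c} ?f1) + ennreal (integral {c..q} ?f2)"
      using A by (subst (1 2) nn) auto
  qed auto
  also have "\<dots> \<le> ennreal (integral {p..c} (\<lambda>t. (\<phi> m t)^2)) + ennreal (integral {c..q} (\<lambda>t. (\<phi> m t)^2))"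
    unfolding Henstock_Kurzweil_Integration.integral_mult_right
    using hardy_left[of \<alpha> p c \<phi> m] hardy_right[of c q \<beta> \<phi> m] ab c der out
    by (intro add_mono ennreal_leI) auto
  also have "\<dots> = ennreal (integral {p..c} (\<lambda>t. (\<phi> m t)^2) + integral {c..q} (\<lambda>t. (\<phi> m t)^2))"
    by (intro ennreal_plus[symmetric] integral_nonneg integrable_continuous_real continuous_intros cont) auto
  also have "\<dots> = ennreal (integral {p..q} (\<lambda>t. (\<phi> m t)^2))"
    by (subst Henstock_Kurzweil_Integration.integral_combine) (auto simp: c intro!: integrable_continuous_real continuous_intros cont)
  also have "\<dots> = (\<integral>\<^sup>+t. ennreal (indicator {p..q} t * (\<phi> m t)^2) \<partial>lborel)"
    by (subst nn) (auto intro!: continuous_intros cont)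
  also have "\<dots> \<le> (\<integral>\<^sup>+t. ennreal ((\<phi> m t)^2) \<partial>lborel)"
    by (intro nn_integral_mono ennreal_leI) (auto simp: indicator_def)
  finally show ?thesis .
qed

subsection \<open>The Finsler norms of an elliptic symbol\<close>

text \<open>Extreme values on the compact unit sphere, extended by homogeneity. It serves both the
  symbol and the spherical integral.\<close>

lemma homogeneous_bounds:
  fixes G :: "'a::euclidean_space \<Rightarrow> real"
  assumes cont: "continuous_on UNIV G" and hom: "\<And>c x. G (c *\<^sub>R x) = c ^ k * G x"
    and pos: "\<And>x. x \<noteq> 0 \<Longrightarrow> G x > 0" and k: "k > 0"
  shows "\<exists>c1>0. \<exists>c2>0. \<forall>x. c1 * norm x ^ k \<le> G x \<and> G x \<le> c2 * norm x ^ k"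
proof -
  let ?S = "sphere (0::'a) 1"
  obtain b :: 'a where "b \<in> Basis" using nonempty_Basis by blast
  then have ne: "?S \<noteq> {}" by (auto simp: set_eq_iff intro!: exI[of _ b])
  have c: "compact ?S" "continuous_on ?S G" using cont by (auto intro: continuous_on_subset)
  obtain y where y: "y \<in> ?S" "\<And>x. x \<in> ?S \<Longrightarrow> G y \<le> G x"
    using continuous_attains_inf[OF c(1) ne c(2)] by blast
  obtain z where z: "z \<in> ?S" "\<And>x. x \<in> ?S \<Longrightarrow> G x \<le> G z"
    using continuous_attains_sup[OF c(1) ne c(2)] by blast
  have red: "G x = norm x ^ k * G (x /\<^sub>R norm x) \<and> x /\<^sub>R norm x \<in> ?S" if "x \<noteq> 0" for x
    using hom[of "norm x" "x /\<^sub>R norm x"] that by simp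
  have G0: "G 0 = 0" using hom[of 0 0] k by (simp add: power_0_left)
  have "y \<noteq> 0" "z \<noteq> 0" using y(1) z(1) by auto
  then have "0 < G y" "0 < G z" by (auto intro: pos)
  moreover have "G y * norm x ^ k \<le> G x \<and> G x \<le> G z * norm x ^ k" for x
  proof (cases "x = 0")
    case False
    have "norm x ^ k * G y \<le> norm x ^ k * G (x /\<^sub>R norm x)" "norm x ^ k * G (x /\<^sub>R norm x) \<le> norm x ^ k * G z"
      using red[OF False] y(2) z(2) by (auto intro!: mult_left_mono)
    then show ?thesis using red[OF False] by (simp add: mult.commute)
  qed (use G0 k in \<open>simp add: power_0_left\<close>)
  ultimately show ?thesis by blast
qed

text \<open>Passes from the gauge integral in \<open>sphere_avg\<close> to a Lebesgue integral, for
  which linearity and Tonelli are used later.\<close>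

lemma sphere_avg_eq:
  fixes g :: "real^'n::finite \<Rightarrow> real"
  assumes [measurable]: "g \<in> borel_measurable borel" and B: "\<And>\<omega>. \<bar>g (\<omega> /\<^sub>R norm \<omega>)\<bar> \<le> B"
  shows "integrable lborel (\<lambda>\<omega>. indicator (ball 0 1) \<omega> * g (\<omega> /\<^sub>R norm \<omega>))"
    and "sphere_avg g = (\<integral>\<omega>. indicator (ball 0 1) \<omega> * g (\<omega> /\<^sub>R norm \<omega>) \<partial>lborel) / measure lebesgue (ball (0::real^'n) 1)"
proof -
  show int: "integrable lborel (\<lambda>\<omega>. indicator (ball 0 1) \<omega> * g (\<omega> /\<^sub>R norm \<omega>))"
  proof (rule Bochner_Integration.integrable_bound)
    have "emeasure lborel (ball (0::real^'n) 1) < \<infinity>" by (rule emeasure_bounded_finite) simp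
    then show "integrable lborel (\<lambda>\<omega>::real^'n. indicator (ball 0 1) \<omega> * B)" by simp
    show "AE \<omega> in lborel. norm (indicator (ball 0 1) \<omega> * g (\<omega> /\<^sub>R norm \<omega>)) \<le> norm (indicator (ball 0 1) \<omega> * B)"
      using B by (intro AE_I2) (auto simp: indicator_def abs_mult intro: order_trans[OF _ abs_ge_self])
    have "(\<lambda>\<omega>. g (\<omega> /\<^sub>R norm \<omega>)) \<in> borel_measurable borel"
      by (rule measurable_compose[OF _ assms(1)]) measurable
    then show "(\<lambda>\<omega>. indicator (ball 0 1) \<omega> * g (\<omega> /\<^sub>R norm \<omega>)) \<in> borel_measurable lborel"
      by (auto intro!: borel_measurable_times borel_measurable_indicator)
  qed
  then have "set_integrable lborel (ball 0 1) (\<lambda>\<omega>. g (\<omega> /\<^sub>R norm \<omega>))"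
    by (simp add: set_integrable_def)
  from set_borel_integral_eq_integral(2)[OF this]
  show "sphere_avg g = (\<integral>\<omega>. indicator (ball 0 1) \<omega> * g (\<omega> /\<^sub>R norm \<omega>) \<partial>lborel) / measure lebesgue (ball (0::real^'n) 1)"
    by (simp add: sphere_avg_def set_lebesgue_integral_def)
qed

lemma measure_ball_pos: "measure lebesgue (ball (0::'a::euclidean_space) 1) > 0"
  using content_ball_pos[of 1 "0::'a"] by simp

locale elliptic_symbol =
  fixes m :: nat and a :: "('n::finite \<Rightarrow> nat) \<Rightarrow> real"
  assumes m_pos: "m \<ge> 1"
    and elliptic: "\<And>\<xi>. \<xi> \<noteq> 0 \<Longrightarrow> symb_H m a \<xi> > 0"
begin

abbreviation "H \<equiv> symb_H m a"
abbreviation "F \<equiv> F_H m a"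
abbreviation "Fs \<equiv> F_H_star m a"
abbreviation "Fss \<equiv> F_H_star2 m a"

lemma symb_scale: "H (c *\<^sub>R \<xi>) = c ^ (2*m) * H \<xi>"
proof -
  have "(\<Prod>i\<in>UNIV. (c * \<xi> $ i) ^ \<alpha> i) = c ^ (2*m) * (\<Prod>i\<in>UNIV. (\<xi> $ i) ^ \<alpha> i)" if "\<alpha> \<in> multi_indices (2*m)" for \<alpha>
    using that by (simp add: power_mult_distrib prod.distrib multi_indices_def mi_order_def power_sum[symmetric])
  then show ?thesis
    unfolding symb_H_def sum_distrib_left by (intro sum.cong refl) (simp add: mult_ac)
qed

lemma symb_uminus: "H (- \<xi>) = H \<xi>"
  using symb_scale[of "-1" \<xi>] by simp

lemma continuous_symb: "continuous_on UNIV H"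
  unfolding symb_H_def by (intro continuous_intros)

lemma symb_0: "H 0 = 0"
  using symb_scale[of 0 0] m_pos by (simp add: power_0_left)

lemma symb_nonneg: "H \<xi> \<ge> 0"
  using elliptic[of \<xi>] symb_0 by (cases "\<xi> = 0") auto

lemma symb_bounds: "\<exists>c1>0. \<exists>c2>0. \<forall>\<xi>. c1 * norm \<xi> ^ (2*m) \<le> H \<xi> \<and> H \<xi> \<le> c2 * norm \<xi> ^ (2*m)"
  using m_pos by (intro homogeneous_bounds continuous_symb symb_scale elliptic) auto

lemma F_bounds: "\<exists>r1>0. \<exists>r2>0. \<forall>\<xi>. r1 * norm \<xi> \<le> F \<xi> \<and> F \<xi> \<le> r2 * norm \<xi>"
proof -
  obtain c1 c2 where c: "c1 > 0" "c2 > 0" "\<And>\<xi>. c1 * norm \<xi> ^ (2*m) \<le> H \<xi>" "\<And>\<xi>. H \<xi> \<le> c2 * norm \<xi> ^ (2*m)"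
    using symb_bounds by blast
  let ?p = "1 / (2 * real m)"
  have p: "(c * norm \<xi> ^ (2*m)) powr ?p = c powr ?p * norm \<xi>" if "c > 0" for c and \<xi> :: "real^'n"
  proof (cases "\<xi> = 0")
    case False
    then have "norm \<xi> ^ (2*m) = norm \<xi> powr (2 * real m)" by (simp flip: powr_realpow)
    then show ?thesis using that False m_pos by (simp add: powr_mult powr_powr)
  qed (use m_pos in \<open>simp add: power_0_left\<close>)
  have "c1 powr ?p * norm \<xi> \<le> F \<xi>" for \<xi>
    unfolding F_H_def p[OF c(1), symmetric] using c by (intro powr_mono2) auto
  moreover have "F \<xi> \<le> c2 powr ?p * norm \<xi>" for \<xi>
    unfolding F_H_def p[OF c(2), symmetric] using c symb_nonneg by (intro powr_mono2) auto
  moreover have "c1 powr ?p > 0" "c2 powr ?p > 0" using c by auto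
  ultimately show ?thesis by blast
qed

lemma F_pos: "\<xi> \<noteq> 0 \<Longrightarrow> F \<xi> > 0"
  unfolding F_H_def using elliptic[of \<xi>] by simp

lemma F_uminus: "F (- \<xi>) = F \<xi>"
  by (simp add: F_H_def symb_uminus)

lemma nonzero_ne: "UNIV - {0} \<noteq> ({} :: (real^'n) set)"
proof -
  have "(vec 1 :: real^'n) \<in> UNIV - {0}" by (simp add: vec_eq_iff)
  then show ?thesis by blast
qed

text \<open>Cauchy-Schwarz; it makes the set in the definition of \<open>F_H_star\<close> bounded,
  so that its real supremum is a genuine one.\<close>

lemma F_quotient_le:
  assumes "r1 > 0" "\<And>\<xi>. r1 * norm \<xi> \<le> F \<xi>" "\<xi> \<noteq> 0"
  shows "(\<omega> \<bullet> \<xi>) / F \<xi> \<le> norm \<omega> / r1"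
proof -
  have "(\<omega> \<bullet> \<xi>) * r1 \<le> (norm \<omega> * norm \<xi>) * r1"
    using assms by (intro mult_right_mono norm_cauchy_schwarz) auto
  also have "\<dots> \<le> norm \<omega> * F \<xi>"
    using mult_left_mono[OF assms(2)[of \<xi>], of "norm \<omega>"] by (simp add: mult_ac)
  finally show ?thesis using assms F_pos[of \<xi>] by (simp add: field_simps)
qed

lemma Fs_ge: "\<xi> \<noteq> 0 \<Longrightarrow> (\<omega> \<bullet> \<xi>) / F \<xi> \<le> Fs \<omega>"
proof -
  assume "\<xi> \<noteq> 0"
  obtain r1 where r: "r1 > 0" "\<And>\<xi>. r1 * norm \<xi> \<le> F \<xi>" using F_bounds by blast
  have "bdd_above ((\<lambda>\<xi>. (\<omega> \<bullet> \<xi>) / F \<xi>) ` (UNIV - {0}))"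
    using F_quotient_le[OF r] by (auto intro!: bdd_aboveI2)
  then show ?thesis unfolding F_H_star_def using \<open>\<xi> \<noteq> 0\<close> by (intro cSUP_upper) auto
qed

lemma Fs_least: "(\<And>\<xi>. \<xi> \<noteq> 0 \<Longrightarrow> (\<omega> \<bullet> \<xi>) / F \<xi> \<le> z) \<Longrightarrow> Fs \<omega> \<le> z"
  unfolding F_H_star_def using nonzero_ne by (intro cSUP_least) auto

text \<open>The upper bound is Cauchy-Schwarz; the lower one tests the supremum at \<omega>
  itself.\<close>

lemma Fs_bounds: "\<exists>s1>0. \<exists>s2>0. \<forall>\<omega>. s1 * norm \<omega> \<le> Fs \<omega> \<and> Fs \<omega> \<le> s2 * norm \<omega>"
proof -
  obtain r1 r2 where r: "r1 > 0" "r2 > 0" "\<And>\<xi>. r1 * norm \<xi> \<le> F \<xi>" "\<And>\<xi>. F \<xi> \<le> r2 * norm \<xi>" using F_bounds by blast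
  have "Fs \<omega> \<le> 1 / r1 * norm \<omega>" for \<omega>
    using F_quotient_le[OF r(1,3)] by (intro Fs_least) auto
  moreover have "1 / r2 * norm \<omega> \<le> Fs \<omega>" for \<omega>
  proof (cases "\<omega> = 0")
    case True
    obtain e :: "real^'n" where "e \<noteq> 0" using nonzero_ne by auto
    then show ?thesis using Fs_ge[of e 0] True by simp
  next
    case False
    have "norm \<omega> * F \<omega> \<le> norm \<omega> * (r2 * norm \<omega>)" by (intro mult_left_mono r) auto
    then have "1 / r2 * norm \<omega> \<le> (\<omega> \<bullet> \<omega>) / F \<omega>"
      using F_pos[OF False] r by (simp add: field_simps power2_norm_eq_inner[symmetric] power2_eq_square)
    then show ?thesis using Fs_ge[OF False, of \<omega>] by simp
  qed
  moreover have "1 / r1 > 0" "1 / r2 > 0" using r by auto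
  ultimately show ?thesis by blast
qed

lemma Fs_pos: "\<omega> \<noteq> 0 \<Longrightarrow> Fs \<omega> > 0"
proof -
  assume "\<omega> \<noteq> 0"
  obtain s where s: "s > 0" "\<And>\<omega>. s * norm \<omega> \<le> Fs \<omega>" using Fs_bounds by blast
  have "0 < s * norm \<omega>" using s \<open>\<omega> \<noteq> 0\<close> by simp
  then show ?thesis using s(2)[of \<omega>] by linarith
qed

lemma Fs_0: "Fs 0 = 0"
proof -
  obtain s1 s2 where "s1 > 0" "s2 > 0" and s: "\<And>\<omega>. s1 * norm \<omega> \<le> Fs \<omega>" "\<And>\<omega>. Fs \<omega> \<le> s2 * norm \<omega>"
    using Fs_bounds by blast
  show ?thesis using s[of 0] by simp
qed

lemma Fs_nonneg: "Fs \<omega> \<ge> 0"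
  using Fs_pos[of \<omega>] Fs_0 by (cases "\<omega> = 0") auto

lemma Fs_uminus: "Fs (- \<omega>) = Fs \<omega>"
proof -
  have "Fs (- \<omega>) \<le> Fs \<omega>" for \<omega>
  proof (rule Fs_least)
    fix \<xi> :: "real^'n" assume "\<xi> \<noteq> 0"
    then show "(- \<omega> \<bullet> \<xi>) / F \<xi> \<le> Fs \<omega>" using Fs_ge[of "- \<xi>" \<omega>] by (simp add: F_uminus)
  qed
  from this[of \<omega>] this[of "- \<omega>"] show ?thesis by simp
qed

lemma Fs_triangle: "Fs (x + y) \<le> Fs x + Fs y"
proof (rule Fs_least)
  fix \<xi> :: "real^'n" assume "\<xi> \<noteq> 0"
  then show "((x + y) \<bullet> \<xi>) / F \<xi> \<le> Fs x + Fs y"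
    using Fs_ge[of \<xi> x] Fs_ge[of \<xi> y] by (simp add: inner_add_left add_divide_distrib)
qed

text \<open>Follows from the triangle inequality and the upper bound by the norm. The resulting
  continuity gives measurability and allows boundary points to be replaced by a dense set.\<close>

lemma Fs_dist: "\<exists>s>0. \<forall>x y. \<bar>Fs x - Fs y\<bar> \<le> s * dist x y"
proof -
  obtain s where s: "s > 0" "\<And>\<omega>. Fs \<omega> \<le> s * norm \<omega>" using Fs_bounds by blast
  have "Fs x - Fs y \<le> s * dist x y" for x y
    using Fs_triangle[of "x - y" y] s(2)[of "x - y"] by (simp add: dist_norm)
  then have "\<bar>Fs x - Fs y\<bar> \<le> s * dist x y" for x y
    by (smt (verit, best) dist_commute)
  with s(1) show ?thesis by blast
qed

lemma continuous_Fs: "continuous_on UNIV Fs"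
proof -
  obtain s where s: "s > 0" "\<And>x y. \<bar>Fs x - Fs y\<bar> \<le> s * dist x y" using Fs_dist by blast
  have "s-lipschitz_on UNIV Fs" using s by (intro lipschitz_onI) (auto simp: dist_real_def)
  then show ?thesis by (rule lipschitz_on_continuous_on)
qed

lemma borel_Fs [measurable]: "Fs \<in> borel_measurable borel"
  by (rule borel_measurable_UNIV[OF continuous_Fs])

text \<open>The lower bound on \<open>Fs\<close> bounds the quotients, so the supremum is again
  genuine; testing at \<xi> itself gives nonnegativity.\<close>

lemma Fss_ge: "\<omega> \<noteq> 0 \<Longrightarrow> (\<xi> \<bullet> \<omega>) / Fs \<omega> \<le> Fss \<xi>"
  and Fss_bounds: "\<exists>r>0. \<forall>\<xi>. 0 \<le> Fss \<xi> \<and> Fss \<xi> \<le> r * norm \<xi>"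
proof -
  obtain s where s: "s > 0" "\<And>\<omega>. s * norm \<omega> \<le> Fs \<omega>" using Fs_bounds by blast
  have le: "(\<xi> \<bullet> \<omega>) / Fs \<omega> \<le> (1 / s) * norm \<xi>" if "\<omega> \<noteq> 0" for \<omega> \<xi>
  proof -
    have "(\<xi> \<bullet> \<omega>) * s \<le> (norm \<xi> * norm \<omega>) * s"
      using s by (intro mult_right_mono norm_cauchy_schwarz) auto
    also have "\<dots> \<le> norm \<xi> * Fs \<omega>"
      using mult_left_mono[OF s(2)[of \<omega>], of "norm \<xi>"] by (simp add: mult_ac)
    finally show ?thesis using s Fs_pos[OF that] by (simp add: field_simps)
  qed
  have bdd: "bdd_above ((\<lambda>\<omega>. (\<xi> \<bullet> \<omega>) / Fs \<omega>) ` (UNIV - {0}))" for \<xi>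
    using le by (auto intro!: bdd_aboveI2)
  show ge: "(\<xi> \<bullet> \<omega>) / Fs \<omega> \<le> Fss \<xi>" if "\<omega> \<noteq> 0" for \<omega> \<xi>
    unfolding F_H_star2_def using bdd that by (intro cSUP_upper) auto
  have "Fss \<xi> \<le> (1 / s) * norm \<xi>" for \<xi>
    unfolding F_H_star2_def using le nonzero_ne by (intro cSUP_least) auto
  moreover have "0 \<le> Fss \<xi>" for \<xi>
  proof (cases "\<xi> = 0")
    case True
    obtain e :: "real^'n" where "e \<noteq> 0" using nonzero_ne by auto
    then show ?thesis using ge[of e 0] True by simp
  next
    case False
    then have "0 \<le> (\<xi> \<bullet> \<xi>) / Fs \<xi>" using Fs_nonneg by simp
    then show ?thesis using ge[OF False, of \<xi>] by simp
  qed
  ultimately show "\<exists>r>0. \<forall>\<xi>. 0 \<le> Fss \<xi> \<and> Fss \<xi> \<le> r * norm \<xi>" using s(1) by (intro exI[of _ "1/s"]) auto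
qed

section \<open>Moments of the spherical kernel\<close>

definition moment_density :: "'n list \<Rightarrow> real^'n \<Rightarrow> real" where
  "moment_density L \<omega> = (\<Prod>i\<leftarrow>L. \<omega> $ i) / Fs \<omega> ^ (2*m)"

lemma borel_moment_density [measurable]: "moment_density L \<in> borel_measurable borel"
proof -
  have [measurable]: "(\<lambda>\<omega>::real^'n. \<Prod>i\<leftarrow>L. \<omega> $ i) \<in> borel_measurable borel"
    by (rule borel_measurable_continuous_onI, induction L) (auto intro!: continuous_intros)
  show ?thesis unfolding moment_density_def by measurable
qed

lemma Fs_unit_bound: "\<exists>B. \<forall>\<omega>. 1 / Fs (\<omega> /\<^sub>R norm \<omega>) ^ (2*m) \<le> B"
proof -
  obtain s where s: "s > 0" "\<And>\<omega>. s * norm \<omega> \<le> Fs \<omega>" using Fs_bounds by blast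
  have "1 / Fs (\<omega> /\<^sub>R norm \<omega>) ^ (2*m) \<le> 1 / s ^ (2*m)" for \<omega>
  proof (cases "\<omega> = 0")
    case True
    \<comment> \<open>At the centre of the ball the radial projection is 0, and the quotient is 0 by
      the convention for division by zero.\<close>
    then show ?thesis using s m_pos by (simp add: Fs_0 power_0_left)
  next
    case False
    then have "s \<le> Fs (\<omega> /\<^sub>R norm \<omega>)" using s(2)[of "\<omega> /\<^sub>R norm \<omega>"] by simp
    then show ?thesis using s by (intro divide_left_mono power_mono) auto
  qed
  then show ?thesis by blast
qed

lemma moment_density_bound: "\<exists>B. \<forall>\<omega>. \<bar>moment_density L (\<omega> /\<^sub>R norm \<omega>)\<bar> \<le> B"
proof -
  obtain B where B: "\<And>\<omega>. 1 / Fs (\<omega> /\<^sub>R norm \<omega>) ^ (2*m) \<le> B" using Fs_unit_bound by blast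
  have "\<bar>\<Prod>i\<leftarrow>L. \<omega> $ i\<bar> \<le> 1" if "norm \<omega> \<le> 1" for \<omega> :: "real^'n"
  proof (induction L)
    case (Cons i L)
    have "\<bar>\<omega> $ i\<bar> \<le> 1" using component_le_norm_cart[of \<omega> i] that by simp
    with Cons show ?case by (simp add: abs_mult mult_le_one)
  qed simp
  then have p: "\<bar>\<Prod>i\<leftarrow>L. (\<omega> /\<^sub>R norm \<omega>) $ i\<bar> \<le> 1" for \<omega> :: "real^'n"
    by (cases "\<omega> = 0") (simp_all del: vector_scaleR_component zero_index)
  have "\<bar>moment_density L (\<omega> /\<^sub>R norm \<omega>)\<bar> \<le> B" for \<omega>
  proof -
    have "\<bar>moment_density L (\<omega> /\<^sub>R norm \<omega>)\<bar> = \<bar>\<Prod>i\<leftarrow>L. (\<omega> /\<^sub>R norm \<omega>) $ i\<bar> * (1 / Fs (\<omega> /\<^sub>R norm \<omega>) ^ (2*m))"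
      unfolding moment_density_def abs_divide using Fs_nonneg[of "\<omega> /\<^sub>R norm \<omega>"]
      by (simp del: vector_scaleR_component)
    also have "\<dots> \<le> 1 * (1 / Fs (\<omega> /\<^sub>R norm \<omega>) ^ (2*m))"
      using p Fs_nonneg by (intro mult_right_mono) auto
    finally show ?thesis using B[of \<omega>] by simp
  qed
  then show ?thesis by blast
qed

text \<open>Equal to \<open>sphere_avg (moment_density L)\<close>, written as a Lebesgue
  integral.\<close>

definition moment :: "'n list \<Rightarrow> real" where
  "moment L = (\<integral>\<omega>. indicator (ball 0 1) \<omega> * moment_density L (\<omega> /\<^sub>R norm \<omega>) \<partial>lborel)
     / measure lebesgue (ball (0::real^'n) 1)"

lemma integrable_moment_density:
  "integrable lborel (\<lambda>\<omega>. indicator (ball 0 1) \<omega> * moment_density L (\<omega> /\<^sub>R norm \<omega>))"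
  using moment_density_bound[of L] sphere_avg_eq(1)[OF borel_moment_density] by blast

abbreviation "kern \<xi> \<omega> \<equiv> (\<xi> \<bullet> \<omega>) ^ (2*m) / Fs \<omega> ^ (2*m)"

text \<open>Expansion over words separates \<xi> from \<omega>.\<close>

lemma kern_sum: "kern \<xi> \<omega> = (\<Sum>L | length L = 2*m. (\<Prod>i\<leftarrow>L. \<xi> $ i) * moment_density L \<omega>)"
  by (simp add: inner_power_eq_sum sum_divide_distrib moment_density_def)

lemma kern_nonneg: "0 \<le> kern \<xi> \<omega>"
  using Fs_nonneg[of \<omega>] by (simp add: zero_le_even_power)

lemma integrable_kern:
  "integrable lborel (\<lambda>\<omega>. indicator (ball 0 1) \<omega> * kern \<xi> (\<omega> /\<^sub>R norm \<omega>))"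
proof -
  have "(\<lambda>\<omega>. indicator (ball 0 1) \<omega> * kern \<xi> (\<omega> /\<^sub>R norm \<omega>)) =
    (\<lambda>\<omega>. \<Sum>L | length L = 2*m. (\<Prod>i\<leftarrow>L. \<xi> $ i) * (indicator (ball 0 1) \<omega> * moment_density L (\<omega> /\<^sub>R norm \<omega>)))"
    unfolding kern_sum by (simp add: sum_distrib_left mult_ac)
  then show ?thesis using integrable_moment_density by simp
qed

lemma sph_int_eq:
  "sph_int m a \<xi> = (\<integral>\<omega>. indicator (ball 0 1) \<omega> * kern \<xi> (\<omega> /\<^sub>R norm \<omega>) \<partial>lborel) / measure lebesgue (ball (0::real^'n) 1)"
proof -
  have "\<exists>B. \<forall>\<omega>. \<bar>kern \<xi> (\<omega> /\<^sub>R norm \<omega>)\<bar> \<le> B"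
  proof -
    obtain B where B: "\<And>L \<omega>. \<bar>moment_density L (\<omega> /\<^sub>R norm \<omega>)\<bar> \<le> B L" using moment_density_bound by metis
    have "\<bar>kern \<xi> (\<omega> /\<^sub>R norm \<omega>)\<bar> \<le> (\<Sum>L | length L = 2*m. \<bar>\<Prod>i\<leftarrow>L. \<xi> $ i\<bar> * B L)" for \<omega>
      unfolding kern_sum
      by (rule order_trans[OF sum_abs]) (auto simp: abs_mult intro!: sum_mono mult_left_mono B)
    then show ?thesis by blast
  qed
  then show ?thesis unfolding sph_int_def
    using sphere_avg_eq(2)[of "kern \<xi>"] by auto
qed

text \<open>Exhibits the spherical integral as a homogeneous polynomial of degree 2m in \<xi>, hence
  as the symbol of a differential operator.\<close>

lemma sph_int_moments: "sph_int m a \<xi> = (\<Sum>L | length L = 2*m. moment L * (\<Prod>i\<leftarrow>L. \<xi> $ i))"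
proof -
  have "(\<integral>\<omega>. indicator (ball 0 1) \<omega> * kern \<xi> (\<omega> /\<^sub>R norm \<omega>) \<partial>lborel)
     = (\<integral>\<omega>. (\<Sum>L | length L = 2*m. (\<Prod>i\<leftarrow>L. \<xi> $ i) * (indicator (ball 0 1) \<omega> * moment_density L (\<omega> /\<^sub>R norm \<omega>))) \<partial>lborel)"
    unfolding kern_sum by (simp add: sum_distrib_left mult_ac)
  also have "\<dots> = (\<Sum>L | length L = 2*m. (\<Prod>i\<leftarrow>L. \<xi> $ i) * (\<integral>\<omega>. indicator (ball 0 1) \<omega> * moment_density L (\<omega> /\<^sub>R norm \<omega>) \<partial>lborel))"
    using integrable_moment_density by simp
  finally show ?thesis
    by (simp add: sph_int_eq moment_def sum_divide_distrib mult_ac)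
qed

lemma sph_int_nonneg: "0 \<le> sph_int m a \<xi>"
  unfolding sph_int_eq using kern_nonneg measure_ball_pos by (intro divide_nonneg_pos integral_nonneg_AE AE_I2) auto

text \<open>The kernel is positive off the hyperplane orthogonal to \<xi>. A zero integral would
  make an open part of the ball negligible and hence empty.\<close>

lemma sph_int_pos:
  assumes "\<xi> \<noteq> 0"
  shows "0 < sph_int m a \<xi>"
proof (rule ccontr)
  let ?f = "\<lambda>\<omega>. indicator (ball 0 1) \<omega> * kern \<xi> (\<omega> /\<^sub>R norm \<omega>)"
  let ?U = "ball 0 1 \<inter> {\<omega>. \<xi> \<bullet> \<omega> \<noteq> 0}"
  assume "\<not> 0 < sph_int m a \<xi>"
  then have "sph_int m a \<xi> = 0" using sph_int_nonneg[of \<xi>] by simp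
  then have "(\<integral>\<omega>. ?f \<omega> \<partial>lborel) = 0"
    using measure_ball_pos[where 'a = "real^'n"] by (simp add: sph_int_eq)
  then have "AE \<omega> in lborel. ?f \<omega> = 0"
    using kern_nonneg by (subst (asm) integral_nonneg_eq_0_iff_AE[OF integrable_kern]) auto
  then have "AE \<omega> in lborel. \<omega> \<notin> ?U"
  proof eventually_elim
    case (elim \<omega>)
    show ?case
    proof
      assume U: "\<omega> \<in> ?U"
      then have "\<omega> \<noteq> 0" by auto
      then have "Fs (\<omega> /\<^sub>R norm \<omega>) > 0" by (intro Fs_pos) simp
      moreover have "\<xi> \<bullet> (\<omega> /\<^sub>R norm \<omega>) \<noteq> 0" using U \<open>\<omega> \<noteq> 0\<close> by simp
      ultimately have "kern \<xi> (\<omega> /\<^sub>R norm \<omega>) \<noteq> 0" by simp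
      with elim U show False by (auto simp del: inner_scaleR_right)
    qed
  qed
  moreover have op: "open ?U" by (intro open_Int open_ball open_Collect_neq continuous_intros)
  ultimately have "?U \<in> null_sets lborel"
    by (subst (asm) AE_iff_null_sets[symmetric]) auto
  then have "negligible ?U" by (simp add: negligible_iff_null_sets null_sets_completionI)
  then have "?U = {}" using op open_not_negligible by blast
  \<comment> \<open>The multiple of \<xi> of norm 1/2 lies in the ball and off the
    hyperplane.\<close>
  moreover have "(1 / (2 * norm \<xi>)) *\<^sub>R \<xi> \<in> ?U" using assms by (simp add: dist_norm)
  ultimately show False by blast
qed

lemma sph_int_bounds: "\<exists>s1>0. \<exists>s2>0. \<forall>\<xi>. s1 * norm \<xi> ^ (2*m) \<le> sph_int m a \<xi> \<and> sph_int m a \<xi> \<le> s2 * norm \<xi> ^ (2*m)"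
proof (intro homogeneous_bounds)
  have "continuous_on UNIV (\<lambda>\<xi>::real^'n. \<Prod>i\<leftarrow>L. \<xi> $ i)" for L
    by (induction L) (auto intro!: continuous_intros)
  then show "continuous_on UNIV (sph_int m a)"
    unfolding sph_int_moments by (intro continuous_intros) auto
  have lp: "(\<Prod>i\<leftarrow>L. (c *\<^sub>R \<xi>) $ i) = c ^ length L * (\<Prod>i\<leftarrow>L. \<xi> $ i)" for c L and \<xi> :: "real^'n"
    by (induction L) auto
  show "sph_int m a (c *\<^sub>R \<xi>) = c ^ (2 * m) * sph_int m a \<xi>" for c \<xi>
    unfolding sph_int_moments lp by (simp add: sum_distrib_left mult_ac)
qed (use sph_int_pos m_pos in auto)

lemma sph_int_0: "sph_int m a 0 = 0"
  using m_pos by (simp add: sph_int_eq power_0_left)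

text \<open>The admissible constants form a nonempty set, by the two-sided bounds, and a bounded
  one, by testing at one vector. The supremum is therefore genuine, and it satisfies the inequality
  itself because each ratio is an upper bound.\<close>

lemma mu_H_nonneg: "0 \<le> mu_H m a"
  and mu_H_le: "mu_H m a * Fss \<xi> ^ (2*m) \<le> sph_int m a \<xi>"
proof -
  let ?S = "{\<mu>. \<mu> > 0 \<and> (\<forall>\<xi>::real^'n. \<mu> * Fss \<xi> ^ (2*m) \<le> sph_int m a \<xi>)}"
  obtain s where s: "s > 0" "\<And>\<xi>. s * norm \<xi> ^ (2*m) \<le> sph_int m a \<xi>" using sph_int_bounds by blast
  obtain r where r: "r > 0" "\<And>\<xi>. 0 \<le> Fss \<xi>" "\<And>\<xi>. Fss \<xi> \<le> r * norm \<xi>" using Fss_bounds by blast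
  have "s / r ^ (2*m) * Fss \<xi> ^ (2*m) \<le> sph_int m a \<xi>" for \<xi>
  proof -
    have "s / r ^ (2*m) * Fss \<xi> ^ (2*m) \<le> s / r ^ (2*m) * (r * norm \<xi>) ^ (2*m)"
      using s r by (intro mult_left_mono power_mono) auto
    also have "\<dots> = s * norm \<xi> ^ (2*m)" using r by (simp add: power_mult_distrib)
    finally show ?thesis using s(2)[of \<xi>] by simp
  qed
  then have mem: "s / r ^ (2*m) \<in> ?S" using s r by simp
  obtain e :: "real^'n" where e: "e \<noteq> 0" using nonzero_ne by auto
  have up: "\<mu> \<le> sph_int m a \<xi> / Fss \<xi> ^ (2*m)" if "\<mu> \<in> ?S" "Fss \<xi> \<noteq> 0" for \<mu> \<xi>
  proof -
    have "Fss \<xi> > 0" using r(2)[of \<xi>] that by simp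
    then show ?thesis using that by (simp add: field_simps)
  qed
  have "(e \<bullet> e) / Fs e > 0" using e Fs_pos by simp
  then have "Fss e \<noteq> 0" using Fss_ge[OF e, of e] by linarith
  then have bdd: "bdd_above ?S" using up by (intro bdd_aboveI) blast
  show "0 \<le> mu_H m a"
    unfolding mu_H_def using cSup_upper[OF mem bdd] mem by (simp add: less_imp_le order_trans)
  show "mu_H m a * Fss \<xi> ^ (2*m) \<le> sph_int m a \<xi>"
  proof (cases "Fss \<xi> = 0")
    case True
    then show ?thesis using m_pos sph_int_nonneg by (simp add: power_0_left)
  next
    case False
    then have "Fss \<xi> > 0" using r(2)[of \<xi>] by simp
    have "mu_H m a \<le> sph_int m a \<xi> / Fss \<xi> ^ (2*m)"
      unfolding mu_H_def using mem up[OF _ False] by (intro cSup_least) blast+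
    then show ?thesis using \<open>Fss \<xi> > 0\<close> by (simp add: field_simps)
  qed
qed

text \<open>Every ratio of the spherical integral to the symbol is a lower bound of the nonempty
  admissible set, hence of its infimum; one positive ratio makes the infimum positive.\<close>

lemma M_H_pos: "0 < M_H m a"
  and M_H_ge: "sph_int m a \<xi> \<le> M_H m a * H \<xi>"
proof -
  let ?S = "{M. M > 0 \<and> (\<forall>\<xi>::real^'n. sph_int m a \<xi> \<le> M * H \<xi>)}"
  obtain s where s: "s > 0" "\<And>\<xi>. sph_int m a \<xi> \<le> s * norm \<xi> ^ (2*m)" using sph_int_bounds by blast
  obtain c where c: "c > 0" "\<And>\<xi>. c * norm \<xi> ^ (2*m) \<le> H \<xi>"
    using symb_bounds by blast
  have "sph_int m a \<xi> \<le> s / c * H \<xi>" for \<xi>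
  proof -
    have "s * norm \<xi> ^ (2*m) = s / c * (c * norm \<xi> ^ (2*m))" using c by simp
    also have "\<dots> \<le> s / c * H \<xi>" using s c by (intro mult_left_mono) auto
    finally show ?thesis using s(2)[of \<xi>] by simp
  qed
  then have mem: "s / c \<in> ?S" using s c by simp
  have ge: "sph_int m a \<xi> / H \<xi> \<le> M_H m a" if "\<xi> \<noteq> 0" for \<xi>
    unfolding M_H_def using mem elliptic[OF that] by (intro cInf_greatest) (auto simp: field_simps)
  obtain e :: "real^'n" where e: "e \<noteq> 0" using nonzero_ne by auto
  have "0 < sph_int m a e / H e" using e sph_int_pos elliptic by simp
  then show "0 < M_H m a" using ge[OF e] by linarith
  show "sph_int m a \<xi> \<le> M_H m a * H \<xi>"
  proof (cases "\<xi> = 0")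
    case False
    then show ?thesis using ge[OF False] elliptic[OF False] by (simp add: field_simps)
  qed (simp add: sph_int_0 symb_0)
qed

end

subsection \<open>The Hardy inequality along lines\<close>

text \<open>Integrating over the slab \<open>0 \<le> x \<bullet> \<omega> \<le> 1\<close>, which each line in direction \<open>\<omega>\<close> crosses in unit
  length, replaces a rotation of the coordinates.\<close>

lemma nn_integral_lines:
  fixes f :: "'a::euclidean_space \<Rightarrow> ennreal"
  assumes [measurable]: "f \<in> borel_measurable borel" and \<omega>: "norm \<omega> = 1"
  shows "(\<integral>\<^sup>+y. f y \<partial>lborel) = (\<integral>\<^sup>+x. indicator {0..1} (x \<bullet> \<omega>) * (\<integral>\<^sup>+t. f (x + t *\<^sub>R \<omega>) \<partial>lborel) \<partial>lborel)"
proof -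
  have "(\<integral>\<^sup>+x. indicator {0..1} (x \<bullet> \<omega>) * (\<integral>\<^sup>+t. f (x + t *\<^sub>R \<omega>) \<partial>lborel) \<partial>lborel)
     = (\<integral>\<^sup>+x. (\<integral>\<^sup>+t. indicator {0..1} (x \<bullet> \<omega>) * f (x + t *\<^sub>R \<omega>) \<partial>lborel) \<partial>lborel)"
    by (simp add: nn_integral_cmult)
  also have "\<dots> = (\<integral>\<^sup>+t. (\<integral>\<^sup>+x. indicator {0..1} (x \<bullet> \<omega>) * f (x + t *\<^sub>R \<omega>) \<partial>lborel) \<partial>(lborel :: real measure))"
    by (rule lborel_pair.Fubini'[symmetric]) measurable
  also have "\<dots> = (\<integral>\<^sup>+t. (\<integral>\<^sup>+y. indicator {0..1} (y \<bullet> \<omega> - t) * f y \<partial>lborel) \<partial>(lborel :: real measure))"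
  proof (rule nn_integral_cong)
    fix t :: real
    have m: "(\<lambda>y. indicator {0..1} (y \<bullet> \<omega> - t) * f y) \<in> borel_measurable borel" by measurable
    have "\<omega> \<bullet> \<omega> = 1" using \<omega> by (simp add: dot_square_norm)
    then show "(\<integral>\<^sup>+x. indicator {0..1} (x \<bullet> \<omega>) * f (x + t *\<^sub>R \<omega>) \<partial>lborel) = (\<integral>\<^sup>+y. indicator {0..1} (y \<bullet> \<omega> - t) * f y \<partial>lborel)"
      using nn_integral_lborel_shift[OF m, of "t *\<^sub>R \<omega>"] by (simp add: inner_add_left)
  qed
  also have "\<dots> = (\<integral>\<^sup>+y. (\<integral>\<^sup>+t. indicator {0..1} (y \<bullet> \<omega> - t) * f y \<partial>(lborel :: real measure)) \<partial>lborel)"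
    by (rule lborel_pair.Fubini') measurable
  also have "\<dots> = (\<integral>\<^sup>+y. f y \<partial>lborel)"
  proof (rule nn_integral_cong)
    fix y
    have "(\<integral>\<^sup>+t. indicator {0..1} (y \<bullet> \<omega> - t) * f y \<partial>(lborel :: real measure))
      = (\<integral>\<^sup>+t. indicator {y \<bullet> \<omega> - 1..y \<bullet> \<omega>} t \<partial>(lborel :: real measure)) * f y"
      by (subst nn_integral_multc[symmetric]) (auto intro!: nn_integral_cong simp: indicator_def)
    also have "(\<integral>\<^sup>+t. indicator {y \<bullet> \<omega> - 1..y \<bullet> \<omega>} t \<partial>(lborel :: real measure)) = 1" by simp
    finally show "(\<integral>\<^sup>+t. indicator {0..1} (y \<bullet> \<omega> - t) * f y \<partial>(lborel :: real measure)) = f y" by simp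
  qed
  finally show ?thesis ..
qed

text \<open>The last hypothesis says that \<open>w\<close> is at most the inverse power of the
  distance to the boundary along the line. The one-dimensional inequality holds on each line, and
  \<open>nn_integral_lines\<close> turns both sides into integrals over the space.\<close>

lemma hardy_direction:
  fixes u :: "real^'n::finite \<Rightarrow> real" and w :: "real^'n \<Rightarrow> ennreal"
  assumes u: "smooth_fun u" and K: "compact K" "\<And>x. x \<notin> K \<Longrightarrow> u x = 0" "K \<subseteq> \<Omega>"
    and \<Omega>: "open \<Omega>" "convex \<Omega>" and \<omega>: "norm \<omega> = 1"
    and w [measurable]: "w \<in> borel_measurable borel"
    and w_le: "\<And>x r. 0 < r \<Longrightarrow> (\<And>t. \<bar>t\<bar> < r \<Longrightarrow> x + t *\<^sub>R \<omega> \<in> \<Omega>) \<Longrightarrow> w x \<le> ennreal (1 / r ^ (2*m))"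
  shows "(\<integral>\<^sup>+x. ennreal (A_const m * (u x)^2) * w x \<partial>lborel) \<le> (\<integral>\<^sup>+x. ennreal ((dir_deriv m \<omega> u x)^2) \<partial>lborel)"
proof -
  let ?D = "\<lambda>k. dir_deriv k \<omega> u"
  have [measurable]: "?D k \<in> borel_measurable borel" for k
    by (rule borel_measurable_UNIV[OF continuous_on_dir_deriv[OF u]])
  have [measurable]: "u \<in> borel_measurable borel"
    by (rule borel_measurable_UNIV[OF smooth_fun_continuous[OF u]])
  have z: "?D k x = 0" if "x \<notin> K" for k x
    using K that by (intro dir_deriv_eq_0[of K u]) (auto intro: compact_imp_closed)
  have line: "(\<integral>\<^sup>+t. ennreal (A_const m * (u (x + t *\<^sub>R \<omega>))^2) * w (x + t *\<^sub>R \<omega>) \<partial>lborel)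
     \<le> (\<integral>\<^sup>+t. ennreal ((?D m (x + t *\<^sub>R \<omega>))^2) \<partial>lborel)" for x
  proof (cases "\<exists>t. x + t *\<^sub>R \<omega> \<in> K")
    case False
    then have "u (x + t *\<^sub>R \<omega>) = 0" for t using K(2) by blast
    then show ?thesis by simp
  next
    case True
    define T where "T = {t. x + t *\<^sub>R \<omega> \<in> K}"
    define I where "I = {t. x + t *\<^sub>R \<omega> \<in> \<Omega>}"
    have Tne: "T \<noteq> {}" using True by (simp add: T_def)
    have "T = (\<lambda>t. x + t *\<^sub>R \<omega>) -` K" by (auto simp: T_def)
    then have Tcl: "closed T"
      using compact_imp_closed[OF K(1)] by (simp only:) (intro closed_vimage continuous_intros)
    obtain B where B: "\<And>y. y \<in> K \<Longrightarrow> norm y \<le> B"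
      using compact_imp_bounded[OF K(1)] by (auto simp: bounded_iff)
    have Tb: "\<bar>t\<bar> \<le> B + norm x" if "t \<in> T" for t
    proof -
      have "\<bar>t\<bar> = norm (t *\<^sub>R \<omega>)" using \<omega> by simp
      also have "\<dots> \<le> norm (x + t *\<^sub>R \<omega>) + norm x" using norm_triangle_ineq4[of "x + t *\<^sub>R \<omega>" x] by simp
      finally show ?thesis using B[of "x + t *\<^sub>R \<omega>"] that by (simp add: T_def)
    qed
    then have bdd: "bdd_below T" "bdd_above T"
      by (auto intro!: bdd_belowI[of _ "- (B + norm x)"] bdd_aboveI[of _ "B + norm x"] simp: abs_le_iff) (smt (verit) Tb)+
    have inT: "Inf T \<in> T" "Sup T \<in> T"
      using closed_contains_Inf[OF Tne bdd(1) Tcl] closed_contains_Sup[OF Tne bdd(2) Tcl] by auto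
    have le: "Inf T \<le> t" "t \<le> Sup T" if "t \<in> T" for t
      using that bdd by (auto intro: cInf_lower cSup_upper)
    have TI: "T \<subseteq> I" using K(3) by (auto simp: T_def I_def)
    have I_vim: "I = (\<lambda>t. x + t *\<^sub>R \<omega>) -` \<Omega>" by (auto simp: I_def)
    have Iop: "open I" unfolding I_vim using \<Omega>(1) by (intro open_vimage continuous_intros)
    have Iint: "t \<in> I" if "a \<in> I" "b \<in> I" "a \<le> t" "t \<le> b" for a b t
    proof (cases "a = b")
      case False
      define l where "l = (t - a) / (b - a)"
      have l: "0 \<le> l" "l \<le> 1" using that False by (auto simp: l_def field_simps)
      have "l * (b - a) = t - a" using False by (simp add: l_def)
      then have t: "t = (1 - l) * a + l * b" by (simp add: algebra_simps)
      have "x + t *\<^sub>R \<omega> = (1 - l) *\<^sub>R (x + a *\<^sub>R \<omega>) + l *\<^sub>R (x + b *\<^sub>R \<omega>)"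
        by (subst t) (simp add: algebra_simps)
      also have "\<dots> \<in> \<Omega>" using \<Omega>(2) that l by (intro convexD) (auto simp: I_def)
      finally show ?thesis by (simp add: I_def)
    qed (use that in auto)
    \<comment> \<open>a subinterval of the line section has the larger weight, so unbounded sections need no separate case\<close>
    obtain e1 where e1: "e1 > 0" "ball (Inf T) e1 \<subseteq> I" using Iop inT TI by (meson open_contains_ball subsetD)
    obtain e2 where e2: "e2 > 0" "ball (Sup T) e2 \<subseteq> I" using Iop inT TI by (meson open_contains_ball subsetD)
    \<comment> \<open>One third leaves room for two steps beyond the extreme points of
      \<open>T\<close>: at distance \<open>e\<close> all derivatives already vanish, and at distance
      2e the line is still in \<Omega>.\<close>
    define e where "e = min e1 e2 / 3"
    have e: "e > 0" "2 * e < e1" "2 * e < e2" using e1 e2 by (auto simp: e_def)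
    have ends: "Inf T - 2 * e \<in> I" "Sup T + 2 * e \<in> I"
      using e e1(2) e2(2) by (auto simp: dist_real_def subset_iff)
    show ?thesis
    proof -
      define \<alpha> p q \<beta> where "\<alpha> = Inf T - 2 * e" and "p = Inf T - e" and "q = Sup T + e" and "\<beta> = Sup T + 2 * e"
      have "(\<integral>\<^sup>+t. ennreal (A_const m * (?D 0 (x + t *\<^sub>R \<omega>))^2) * w (x + t *\<^sub>R \<omega>) \<partial>lborel)
        \<le> (\<integral>\<^sup>+t. ennreal ((?D m (x + t *\<^sub>R \<omega>))^2) \<partial>lborel)"
      proof (rule hardy_interval[where \<alpha> = \<alpha> and \<beta> = \<beta> and p = p and q = q])
        show "\<alpha> < p" "p \<le> q" "q = \<beta> - (p - \<alpha>)"
          using e le[OF inT(1)] by (auto simp: \<alpha>_def p_def q_def \<beta>_def)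
        show "((\<lambda>t. ?D j (x + t *\<^sub>R \<omega>)) has_real_derivative ?D (Suc j) (x + t *\<^sub>R \<omega>)) (at t)" for j t
          by (rule dir_deriv_line[OF u])
        show "?D j (x + t *\<^sub>R \<omega>) = 0" if "t \<le> p \<or> q \<le> t" for j t
        proof -
          have "t \<notin> T" using that e le[of t] by (auto simp: p_def q_def)
          then show ?thesis by (intro z) (simp add: T_def)
        qed
        show "w (x + t *\<^sub>R \<omega>) \<le> ennreal (1 / min (t - \<alpha>) (\<beta> - t) ^ (2 * m))" if t: "p < t" "t < q" for t
        proof (rule w_le)
          show "0 < min (t - \<alpha>) (\<beta> - t)" using t e by (auto simp: \<alpha>_def p_def q_def \<beta>_def)
          fix s assume s: "\<bar>s\<bar> < min (t - \<alpha>) (\<beta> - t)"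
          have "t + s \<in> I" by (rule Iint[OF ends]) (use s in \<open>auto simp: \<alpha>_def \<beta>_def\<close>)
          then show "x + t *\<^sub>R \<omega> + s *\<^sub>R \<omega> \<in> \<Omega>" by (simp add: I_def algebra_simps)
        qed
      qed
      then show ?thesis by simp
    qed
  qed
  have "(\<integral>\<^sup>+x. ennreal (A_const m * (u x)^2) * w x \<partial>lborel)
    = (\<integral>\<^sup>+x. indicator {0..1} (x \<bullet> \<omega>) * (\<integral>\<^sup>+t. ennreal (A_const m * (u (x + t *\<^sub>R \<omega>))^2) * w (x + t *\<^sub>R \<omega>) \<partial>lborel) \<partial>lborel)"
    by (rule nn_integral_lines[OF _ \<omega>]) measurable
  also have "\<dots> \<le> (\<integral>\<^sup>+x. indicator {0..1} (x \<bullet> \<omega>) * (\<integral>\<^sup>+t. ennreal ((?D m (x + t *\<^sub>R \<omega>))^2) \<partial>lborel) \<partial>lborel)"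
    by (intro nn_integral_mono mult_left_mono line) auto
  also have "\<dots> = (\<integral>\<^sup>+x. ennreal ((?D m x)^2) \<partial>lborel)"
    by (rule nn_integral_lines[OF _ \<omega>, symmetric]) measurable
  finally show ?thesis .
qed

subsection \<open>Averaging over directions\<close>

text \<open>Guarantees that the choice made in \<open>Dalpha\<close> picks a list with the
  prescribed counts.\<close>

lemma ex_count_list: "\<exists>L. \<forall>i. count_list L i = (\<alpha> :: 'n::finite \<Rightarrow> nat) i"
proof -
  have rep: "count_list (replicate k x) i = (if i = x then k else 0)" for k and x i :: 'n
    by (induction k) auto
  have "\<exists>L. \<forall>i. count_list L i = (if i \<in> A then \<alpha> i else 0)" if "finite A" for A
    using that
  proof (induction A)
    case empty
    then show ?case by (intro exI[of _ "[]"]) simp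
  next
    case (insert x A)
    then obtain L where "\<forall>i. count_list L i = (if i \<in> A then \<alpha> i else 0)" by blast
    with insert show ?case by (intro exI[of _ "replicate (\<alpha> x) x @ L"]) (auto simp: rep)
  qed
  from this[of UNIV] show ?thesis by simp
qed

text \<open>Names the list chosen in \<open>Dalpha\<close>, so that \<open>Dalpha \<alpha>\<close>
  unfolds to the iterated derivative along this list.\<close>

definition mi_list :: "('n::finite \<Rightarrow> nat) \<Rightarrow> 'n list" where
  "mi_list \<alpha> = (SOME L. \<forall>i. count_list L i = \<alpha> i)"

lemma count_mi_list: "count_list (mi_list \<alpha>) i = \<alpha> i"
  using someI_ex[OF ex_count_list[of \<alpha>]] unfolding mi_list_def by blast

lemma length_mi_list: "length (mi_list \<alpha>) = mi_order \<alpha>"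
  using sum_count_set[of "mi_list \<alpha>" UNIV] by (simp add: count_mi_list mi_order_def)

lemma prod_mi_list: "(\<Prod>i\<leftarrow>mi_list \<alpha>. f i) = (\<Prod>i\<in>UNIV. (f i :: 'b::comm_monoid_mult) ^ \<alpha> i)"
proof -
  have "(\<Prod>i\<leftarrow>L. f i) = (\<Prod>i\<in>UNIV. f i ^ count_list L i)" for L
  proof (induction L)
    case (Cons x L)
    have "(\<Prod>i\<in>UNIV. f i ^ count_list (x # L) i) = (\<Prod>i\<in>UNIV. (if i = x then f i else 1) * f i ^ count_list L i)"
      by (intro prod.cong) auto
    then show ?case by (simp add: Cons prod.distrib)
  qed simp
  then show ?thesis by (simp add: count_mi_list)
qed

context elliptic_symbol
begin

text \<open>A sum over an infinite set is 0 by convention, so an infinite index set would make the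
  symbol vanish and contradict ellipticity.\<close>

lemma finite_multi_indices: "finite (multi_indices (2*m) :: ('n \<Rightarrow> nat) set)"
proof (rule ccontr)
  assume "\<not> ?thesis"
  then have "H \<xi> = 0" for \<xi> by (simp add: symb_H_def)
  moreover obtain e :: "real^'n" where "e \<noteq> 0" using nonzero_ne by auto
  ultimately show False using elliptic by fastforce
qed

section \<open>Weights from countably many supporting hyperplanes\<close>

context
  fixes \<Omega> :: "(real^'n) set" and D :: "(real^'n) set" and \<nu> :: "real^'n \<Rightarrow> real^'n"
  assumes D: "countable D" "D \<subseteq> frontier \<Omega>" "frontier \<Omega> \<subseteq> closure D"
    and bdry: "frontier \<Omega> \<noteq> {}"
    and \<nu>: "\<And>x y. x \<in> \<Omega> \<Longrightarrow> y \<in> D \<Longrightarrow> \<nu> y \<bullet> x < \<nu> y \<bullet> y"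
begin

text \<open>A lower bound for the inverse power of the distance to the boundary along a line. Only countably many
  supporting hyperplanes are used, so that measurability is immediate.\<close>

definition line_weight :: "real^'n \<Rightarrow> real^'n \<Rightarrow> ennreal" where
  "line_weight x \<omega> = (SUP y\<in>D. ennreal (((\<nu> y \<bullet> \<omega>) / (\<nu> y \<bullet> (y - x))) ^ (2*m)))"

lemma borel_line_weight [measurable (raw)]:
  assumes [measurable]: "f \<in> borel_measurable M" "g \<in> borel_measurable M"
  shows "(\<lambda>x. line_weight (f x) (g x)) \<in> borel_measurable M"
  unfolding line_weight_def using D(1) by measurable

text \<open>A segment of half-length \<open>r\<close> inside \<Omega> cannot reach any of the
  supporting hyperplanes, which bounds each quotient in the supremum by 1/r in absolute
  value.\<close>

lemma line_weight_le:
  assumes r: "0 < r" and ins: "\<And>t. \<bar>t\<bar> < r \<Longrightarrow> x + t *\<^sub>R \<omega> \<in> \<Omega>"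
  shows "line_weight x \<omega> \<le> ennreal (1 / r ^ (2*m))"
  unfolding line_weight_def
proof (intro SUP_least ennreal_leI)
  fix y assume y: "y \<in> D"
  have "x \<in> \<Omega>" using ins[of 0] r by simp
  then have s: "0 < \<nu> y \<bullet> (y - x)" using \<nu>[OF _ y] by (simp add: inner_diff_right)
  have "\<bar>\<nu> y \<bullet> \<omega>\<bar> * r \<le> \<nu> y \<bullet> (y - x)"
  proof (rule ccontr)
    assume c: "\<not> ?thesis"
    \<comment> \<open>The parameter at which the line meets the hyperplane; if it were below
      \<open>r\<close> in absolute value, a point of \<Omega> would lie on the hyperplane.\<close>
    define t where "t = (\<nu> y \<bullet> (y - x)) / (\<nu> y \<bullet> \<omega>)"
    have nz: "\<nu> y \<bullet> \<omega> \<noteq> 0" using c s by auto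
    then have "\<bar>t\<bar> < r" using c s by (simp add: t_def abs_divide field_simps)
    then have "\<nu> y \<bullet> (x + t *\<^sub>R \<omega>) < \<nu> y \<bullet> y" using ins \<nu> y by blast
    then show False using nz by (simp add: t_def inner_add_right inner_diff_right)
  qed
  then have "\<bar>(\<nu> y \<bullet> \<omega>) / (\<nu> y \<bullet> (y - x))\<bar> \<le> 1 / r" using s r by (simp add: abs_divide field_simps)
  then have "\<bar>(\<nu> y \<bullet> \<omega>) / (\<nu> y \<bullet> (y - x))\<bar> ^ (2*m) \<le> (1 / r) ^ (2*m)" by (intro power_mono) auto
  then show "((\<nu> y \<bullet> \<omega>) / (\<nu> y \<bullet> (y - x))) ^ (2*m) \<le> 1 / r ^ (2*m)"
    by (simp only: power_even_abs[OF dvd_triv_left] power_one_over)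
qed

text \<open>The infimum runs over the whole boundary, but the sublevel set is open and so meets the
  dense set \<open>D\<close> once it meets the boundary.\<close>

lemma d_H_approx:
  assumes "0 < e"
  obtains y where "y \<in> D" "Fs (x - y) < d_H m a \<Omega> x + e"
proof -
  have "bdd_below ((\<lambda>y. Fs (x - y)) ` frontier \<Omega>)" using Fs_nonneg by (auto intro!: bdd_belowI2)
  then obtain z where z: "z \<in> frontier \<Omega>" "Fs (x - z) < d_H m a \<Omega> x + e"
    using cINF_less_iff[OF bdry, of "\<lambda>y. Fs (x - y)" "d_H m a \<Omega> x + e"] assms by (auto simp: d_H_def)
  have "open {y. Fs (x - y) < d_H m a \<Omega> x + e}"
    by (intro open_Collect_less continuous_on_compose2[OF continuous_Fs] continuous_intros) auto
  moreover have "z \<in> closure D" using z D by blast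
  ultimately have "D \<inter> {y. Fs (x - y) < d_H m a \<Omega> x + e} \<noteq> {}"
    using z(2) open_Int_closure_eq_empty[of "{y. Fs (x - y) < d_H m a \<Omega> x + e}" D] by blast
  then show ?thesis using that by blast
qed

lemma d_H_nonneg: "0 \<le> d_H m a \<Omega> x"
  unfolding d_H_def using bdry Fs_nonneg by (intro cINF_greatest) auto

lemma line_weight_avg:
  assumes x: "x \<in> \<Omega>"
  defines "V \<equiv> measure lebesgue (ball (0::real^'n) 1)"
  shows "ennreal (V * mu_H m a / d_H m a \<Omega> x ^ (2*m))
    \<le> (\<integral>\<^sup>+\<omega>. ennreal (indicator (ball 0 1) \<omega> / Fs (\<omega> /\<^sub>R norm \<omega>) ^ (2*m)) * line_weight x (\<omega> /\<^sub>R norm \<omega>) \<partial>lborel)"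
    (is "_ \<le> ?I")
proof -
  have V: "V > 0" unfolding V_def by (rule measure_ball_pos)
  have y_bound: "ennreal (V * mu_H m a / Fs (x - y) ^ (2*m)) \<le> ?I" if y: "y \<in> D" for y
  proof -
    define s where "s = \<nu> y \<bullet> (y - x)"
    have s: "s > 0" using \<nu>[OF x y] by (simp add: s_def inner_diff_right)
    then have yx: "y - x \<noteq> 0" by (auto simp: s_def)
    have F: "Fs (y - x) = Fs (x - y)" using Fs_uminus[of "x - y"] by simp
    have Fp: "Fs (x - y) > 0" using Fs_pos[OF yx] F by simp
    \<comment> \<open>The supremum \<open>Fss (\<nu> y)\<close> is tested in the direction y -
      x.\<close>
    have "s / Fs (x - y) \<le> Fss (\<nu> y)" using Fss_ge[OF yx, of "\<nu> y"] by (simp add: s_def F)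
    then have "(s / Fs (x - y)) ^ (2*m) \<le> Fss (\<nu> y) ^ (2*m)" using s Fp by (intro power_mono) auto
    then have "mu_H m a * (s / Fs (x - y)) ^ (2*m) \<le> mu_H m a * Fss (\<nu> y) ^ (2*m)"
      using mu_H_nonneg by (rule mult_left_mono)
    also have "\<dots> \<le> sph_int m a (\<nu> y)" by (rule mu_H_le)
    finally have "mu_H m a / Fs (x - y) ^ (2*m) \<le> sph_int m a (\<nu> y) / s ^ (2*m)"
      using s Fp by (simp add: field_simps power_divide)
    then have "V * (mu_H m a / Fs (x - y) ^ (2*m)) \<le> V * (sph_int m a (\<nu> y) / s ^ (2*m))"
      using V by (intro mult_left_mono) auto
    then have "ennreal (V * mu_H m a / Fs (x - y) ^ (2*m)) \<le> ennreal (V * sph_int m a (\<nu> y) / s ^ (2*m))"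
      by (intro ennreal_leI) simp
    also have "V * sph_int m a (\<nu> y) / s ^ (2*m) = (\<integral>\<omega>. indicator (ball 0 1) \<omega> * kern (\<nu> y) (\<omega> /\<^sub>R norm \<omega>) / s ^ (2*m) \<partial>lborel)"
      using V by (simp only: integral_divide_zero) (simp add: sph_int_eq V_def)
    also have "ennreal \<dots> = (\<integral>\<^sup>+\<omega>. ennreal (indicator (ball 0 1) \<omega> * kern (\<nu> y) (\<omega> /\<^sub>R norm \<omega>) / s ^ (2*m)) \<partial>lborel)"
      using kern_nonneg s integrable_kern
      by (intro nn_integral_eq_integral[symmetric] integrable_divide AE_I2 divide_nonneg_nonneg mult_nonneg_nonneg) auto
    also have "\<dots> \<le> ?I"
    proof (rule nn_integral_mono)
      fix \<omega> :: "real^'n"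
      let ?o = "\<omega> /\<^sub>R norm \<omega>"
      have "ennreal (indicator (ball 0 1) \<omega> * kern (\<nu> y) ?o / s ^ (2*m))
        = ennreal (indicator (ball 0 1) \<omega> / Fs ?o ^ (2*m)) * ennreal (((\<nu> y \<bullet> ?o) / (\<nu> y \<bullet> (y - x))) ^ (2*m))"
        using Fs_nonneg[of ?o] by (subst ennreal_mult[symmetric]) (auto simp: s_def power_divide zero_le_even_power simp del: inner_scaleR_right)
      also have "\<dots> \<le> ennreal (indicator (ball 0 1) \<omega> / Fs ?o ^ (2*m)) * line_weight x ?o"
        unfolding line_weight_def using y by (intro mult_left_mono SUP_upper) auto
      finally show "ennreal (indicator (ball 0 1) \<omega> * kern (\<nu> y) ?o / s ^ (2*m)) \<le> ennreal (indicator (ball 0 1) \<omega> / Fs ?o ^ (2*m)) * line_weight x ?o" .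
    qed
    finally show ?thesis .
  qed
  show ?thesis
  proof (cases "d_H m a \<Omega> x = 0")
    \<comment> \<open>Division by zero yields 0, so the left side vanishes.\<close>
    case True
    then show ?thesis using m_pos by (simp add: power_0_left)
  next
    case False
    then have d: "d_H m a \<Omega> x > 0" using d_H_nonneg[of x] by simp
    \<comment> \<open>Points of \<open>D\<close> realise the distance only up to \<open>e\<close>;
      the bound holds for each positive \<open>e\<close> and passes to the limit.\<close>
    have "((\<lambda>e. ennreal (V * mu_H m a / (d_H m a \<Omega> x + e) ^ (2*m))) \<longlongrightarrow> ennreal (V * mu_H m a / (d_H m a \<Omega> x + 0) ^ (2*m))) (at_right 0)"
      using d by (intro tendsto_intros) auto
    moreover have "\<forall>\<^sub>F e in at_right 0. ennreal (V * mu_H m a / (d_H m a \<Omega> x + e) ^ (2*m)) \<le> ?I"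
      using eventually_at_right_less[of "0::real"]
    proof eventually_elim
      case (elim e)
      obtain y where y: "y \<in> D" "Fs (x - y) < d_H m a \<Omega> x + e" using d_H_approx[OF elim] by blast
      have "\<nu> y \<bullet> x < \<nu> y \<bullet> y" by (rule \<nu>[OF x y(1)])
      then have "x - y \<noteq> 0" by auto
      then have "Fs (x - y) > 0" by (rule Fs_pos)
      then have "V * mu_H m a / (d_H m a \<Omega> x + e) ^ (2*m) \<le> V * mu_H m a / Fs (x - y) ^ (2*m)"
        using V mu_H_nonneg y d elim by (intro divide_left_mono power_mono mult_nonneg_nonneg) auto
      then show ?case using y_bound[OF y(1)] by (meson ennreal_leI order_trans)
    qed
    ultimately show ?thesis by (intro tendsto_upperbound[where F = "at_right (0::real)"]) auto
  qed
qed

text \<open>\<open>E\<close> is the spherical average of the energies of the \<open>m\<close>-th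
  directional derivatives divided by the power of \<open>Fs\<close>. Tonelli exchanges this average
  with the integral over \<open>x\<close>, and the inequality for a fixed direction is applied
  inside.\<close>

lemma weighted_energy_bound:
  fixes u :: "real^'n \<Rightarrow> real"
  assumes u: "smooth_fun u" and K: "compact K" "\<And>x. x \<notin> K \<Longrightarrow> u x = 0" "K \<subseteq> \<Omega>"
    and \<Omega>: "open \<Omega>" "convex \<Omega>"
  defines "V \<equiv> measure lebesgue (ball (0::real^'n) 1)"
    and "E \<equiv> \<Sum>L | length L = 2*m. moment L * ((-1)^m * (\<integral>x. u x * iter_partial L u x \<partial>lborel))"
  shows "0 \<le> E"
    and "(\<integral>\<^sup>+x. ennreal (A_const m * (u x)^2) * ennreal (V * mu_H m a / d_H m a \<Omega> x ^ (2*m)) \<partial>lborel) \<le> ennreal (V * E)"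
proof -
  have V: "V > 0" unfolding V_def by (rule measure_ball_pos)
  define Q where "Q = (\<lambda>\<omega>. \<integral>x. (dir_deriv m \<omega> u x)^2 \<partial>lborel)"
  have z: "dir_deriv k \<omega> u x = 0" if "x \<notin> K" for k x \<omega>
    using K that by (intro dir_deriv_eq_0[of K u]) (auto intro: compact_imp_closed)
  have cu: "continuous_on UNIV u" using u by (rule smooth_fun_continuous)
  have [measurable]: "u \<in> borel_measurable borel" by (rule borel_measurable_UNIV[OF cu])
  have int_Q: "integrable lborel (\<lambda>x. (dir_deriv m \<omega> u x)^2)" for \<omega>
    by (rule integrable_compact_support[of _ K]) (auto intro!: continuous_intros continuous_on_dir_deriv u K z)
  have int_L: "integrable lborel (\<lambda>x. u x * iter_partial L u x)" for L
    using smooth_fun_continuous[OF smooth_fun_iter[OF u]]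
    by (intro integrable_compact_support[of _ K] continuous_on_mult cu K) (auto intro: K)
  \<comment> \<open>After \<open>m\<close> integrations by parts the energy is a polynomial in
    \<omega>, so averaging it only involves the moments.\<close>
  have Q_eq: "Q \<omega> = (\<Sum>L | length L = 2*m. (\<Prod>i\<leftarrow>L. \<omega> $ i) * ((-1)^m * (\<integral>x. u x * iter_partial L u x \<partial>lborel)))" for \<omega>
  proof -
    have "(\<integral>x. u x * dir_deriv (m + m) \<omega> u x \<partial>lborel) = (-1)^m * Q \<omega>"
      using integral_dir_deriv_shift[OF u K(1), of 0 \<omega> m m] K(2) by (simp add: Q_def power2_eq_square)
    then have "Q \<omega> = (-1)^m * (\<integral>x. u x * dir_deriv (2*m) \<omega> u x \<partial>lborel)"
      by (simp add: mult_2 flip: mult.assoc power_add)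
    also have "(\<integral>x. u x * dir_deriv (2*m) \<omega> u x \<partial>lborel)
      = (\<integral>x. (\<Sum>L | length L = 2*m. (\<Prod>i\<leftarrow>L. \<omega> $ i) * (u x * iter_partial L u x)) \<partial>lborel)"
      by (simp add: dir_deriv_def sum_distrib_left mult_ac)
    also have "\<dots> = (\<Sum>L | length L = 2*m. (\<Prod>i\<leftarrow>L. \<omega> $ i) * (\<integral>x. u x * iter_partial L u x \<partial>lborel))"
      using int_L by simp
    finally show ?thesis by (simp add: sum_distrib_left mult_ac)
  qed
  let ?o = "\<lambda>\<omega>::real^'n. \<omega> /\<^sub>R norm \<omega>"
  have [measurable]: "?o \<in> borel_measurable borel" by measurable
  have [measurable]: "ball (0::real^'n) 1 \<in> sets borel" by simp
  let ?J = "\<lambda>\<omega>. indicator (ball 0 1) \<omega> / Fs (?o \<omega>) ^ (2*m) * Q (?o \<omega>)"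
  have J_eq: "?J \<omega> = (\<Sum>L | length L = 2*m. (indicator (ball 0 1) \<omega> * moment_density L (?o \<omega>))
      * ((-1)^m * (\<integral>x. u x * iter_partial L u x \<partial>lborel)))" for \<omega>
    unfolding Q_eq moment_density_def sum_distrib_left by (intro sum.cong refl) simp
  have int_J: "integrable lborel ?J"
    unfolding J_eq using integrable_moment_density by simp
  have "V * E = (\<Sum>L | length L = 2*m. (\<integral>\<omega>. indicator (ball 0 1) \<omega> * moment_density L (?o \<omega>) \<partial>lborel)
      * ((-1)^m * (\<integral>x. u x * iter_partial L u x \<partial>lborel)))"
    using V unfolding E_def moment_def V_def[symmetric] sum_distrib_left by (intro sum.cong refl) simp
  also have "\<dots> = (\<integral>\<omega>. ?J \<omega> \<partial>lborel)"
    unfolding J_eq using integrable_moment_density by simp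
  finally have VE: "V * E = (\<integral>\<omega>. ?J \<omega> \<partial>lborel)" .
  have Q_nonneg: "0 \<le> Q \<omega>" for \<omega> by (simp add: Q_def)
  have J_nonneg: "0 \<le> ?J \<omega>" for \<omega>
    using Fs_nonneg[of "?o \<omega>"] Q_nonneg by (intro mult_nonneg_nonneg divide_nonneg_nonneg) auto
  have "0 \<le> V * E" unfolding VE using J_nonneg by (intro integral_nonneg_AE AE_I2)
  then show "0 \<le> E" using V by (simp add: zero_le_mult_iff)
  let ?W = "\<lambda>\<omega>. ennreal (indicator (ball 0 1) \<omega> / Fs (?o \<omega>) ^ (2*m))"
  have "(\<integral>\<^sup>+x. ennreal (A_const m * (u x)^2) * ennreal (V * mu_H m a / d_H m a \<Omega> x ^ (2*m)) \<partial>lborel)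
    \<le> (\<integral>\<^sup>+x. ennreal (A_const m * (u x)^2) * (\<integral>\<^sup>+\<omega>. ?W \<omega> * line_weight x (?o \<omega>) \<partial>lborel) \<partial>lborel)"
  proof (rule nn_integral_mono)
    fix x
    show "ennreal (A_const m * (u x)^2) * ennreal (V * mu_H m a / d_H m a \<Omega> x ^ (2*m))
      \<le> ennreal (A_const m * (u x)^2) * (\<integral>\<^sup>+\<omega>. ?W \<omega> * line_weight x (?o \<omega>) \<partial>lborel)"
    proof (cases "x \<in> \<Omega>")
      case True
      then show ?thesis unfolding V_def by (intro mult_left_mono line_weight_avg) auto
    next
      case False
      then have "u x = 0" using K by blast
      then show ?thesis by simp
    qed
  qed
  also have "\<dots> = (\<integral>\<^sup>+x. (\<integral>\<^sup>+\<omega>. ?W \<omega> * (ennreal (A_const m * (u x)^2) * line_weight x (?o \<omega>)) \<partial>lborel) \<partial>lborel)"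
  proof (rule nn_integral_cong)
    fix x
    have "(\<lambda>\<omega>. ?W \<omega> * line_weight x (?o \<omega>)) \<in> borel_measurable lborel" by measurable
    from nn_integral_cmult[OF this, of "ennreal (A_const m * (u x)^2)"]
    show "ennreal (A_const m * (u x)^2) * (\<integral>\<^sup>+\<omega>. ?W \<omega> * line_weight x (?o \<omega>) \<partial>lborel)
      = (\<integral>\<^sup>+\<omega>. ?W \<omega> * (ennreal (A_const m * (u x)^2) * line_weight x (?o \<omega>)) \<partial>lborel)"
      by (simp only: mult_ac)
  qed
  also have "\<dots> = (\<integral>\<^sup>+\<omega>. (\<integral>\<^sup>+x. ?W \<omega> * (ennreal (A_const m * (u x)^2) * line_weight x (?o \<omega>)) \<partial>lborel) \<partial>lborel)"
    by (rule lborel_pair.Fubini'[symmetric]) measurable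
  also have "\<dots> = (\<integral>\<^sup>+\<omega>. ?W \<omega> * (\<integral>\<^sup>+x. ennreal (A_const m * (u x)^2) * line_weight x (?o \<omega>) \<partial>lborel) \<partial>lborel)"
    by (intro nn_integral_cong nn_integral_cmult) measurable
  also have "\<dots> \<le> (\<integral>\<^sup>+\<omega>. ennreal (?J \<omega>) \<partial>lborel)"
  proof (rule nn_integral_mono)
    fix \<omega> :: "real^'n"
    show "?W \<omega> * (\<integral>\<^sup>+x. ennreal (A_const m * (u x)^2) * line_weight x (?o \<omega>) \<partial>lborel) \<le> ennreal (?J \<omega>)"
    proof (cases "\<omega> = 0")
      case True
      \<comment> \<open>The origin determines no direction; the factor in front is 0 there, again by
        division by zero.\<close>
      then show ?thesis using m_pos by (simp add: Fs_0 power_0_left)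
    next
      case False
      have "(\<integral>\<^sup>+x. ennreal (A_const m * (u x)^2) * line_weight x (?o \<omega>) \<partial>lborel)
        \<le> (\<integral>\<^sup>+x. ennreal ((dir_deriv m (?o \<omega>) u x)^2) \<partial>lborel)"
        using False line_weight_le by (intro hardy_direction[OF u K \<Omega>]) auto
      also have "\<dots> = ennreal (Q (?o \<omega>))"
        unfolding Q_def using int_Q by (intro nn_integral_eq_integral) auto
      finally have "?W \<omega> * (\<integral>\<^sup>+x. ennreal (A_const m * (u x)^2) * line_weight x (?o \<omega>) \<partial>lborel) \<le> ?W \<omega> * ennreal (Q (?o \<omega>))"
        by (intro mult_left_mono) auto
      also have "\<dots> = ennreal (?J \<omega>)"
        using Fs_nonneg[of "?o \<omega>"] Q_nonneg by (intro ennreal_mult[symmetric]) auto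
      finally show ?thesis .
    qed
  qed
  also have "\<dots> = ennreal (V * E)"
    unfolding VE using int_J J_nonneg by (intro nn_integral_eq_integral) auto
  finally show "(\<integral>\<^sup>+x. ennreal (A_const m * (u x)^2) * ennreal (V * mu_H m a / d_H m a \<Omega> x ^ (2*m)) \<partial>lborel) \<le> ennreal (V * E)" .
qed

end

text \<open>The symbol \<open>M_H m a * H \<xi> - sph_int m a \<xi>\<close> is nonnegative, hence so
  is its quadratic form.\<close>

lemma energy_le_quadratic_form:
  fixes u :: "real^'n \<Rightarrow> real"
  assumes u: "smooth_fun u" and K: "compact K" "\<And>x. x \<notin> K \<Longrightarrow> u x = 0"
  shows "(\<Sum>L | length L = 2*m. moment L * ((-1)^m * (\<integral>x. u x * iter_partial L u x \<partial>lborel)))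
    \<le> M_H m a * ((-1)^m * (\<Sum>\<alpha>\<in>multi_indices (2*m). a \<alpha> * (\<integral>x. u x * iter_partial (mi_list \<alpha>) u x \<partial>lborel)))"
proof -
  let ?I = "\<lambda>L. \<integral>x. u x * iter_partial L u x \<partial>lborel"
  \<comment> \<open>A disjoint sum keeps the multi-indices of the operator and the words of the
    moments as one family of terms, without rewriting either in terms of the other.\<close>
  let ?S = "(multi_indices (2*m) :: ('n \<Rightarrow> nat) set) <+> {L :: 'n list. length L = 2*m}"
  let ?c = "case_sum (\<lambda>\<alpha>. M_H m a * a \<alpha>) (\<lambda>L. - moment L)"
  let ?L = "case_sum mi_list id"
  have "0 \<le> (-1)^m * (\<Sum>s\<in>?S. ?c s * ?I (?L s))"
  proof (rule quadratic_form_nonneg[OF u K(1)])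
    show "finite ?S" using finite_multi_indices by simp
    show "length (?L s) = 2*m" if "s \<in> ?S" for s
      using that by (auto simp: length_mi_list multi_indices_def)
    fix f :: "'n \<Rightarrow> real"
    have "(\<Sum>s\<in>?S. ?c s * (\<Prod>i\<leftarrow>?L s. f i)) = M_H m a * H (\<chi> i. f i) - sph_int m a (\<chi> i. f i)"
      using finite_multi_indices
      by (simp add: sum.Plus symb_H_def sph_int_moments prod_mi_list sum_distrib_left sum_negf mult.assoc)
    also have "\<dots> \<ge> 0" using M_H_ge by simp
    finally show "0 \<le> (\<Sum>s\<in>?S. ?c s * (\<Prod>i\<leftarrow>?L s. f i))" .
  qed (use K in auto)
  also have "(\<Sum>s\<in>?S. ?c s * ?I (?L s)) = M_H m a * (\<Sum>\<alpha>\<in>multi_indices (2*m). a \<alpha> * ?I (mi_list \<alpha>)) - (\<Sum>L | length L = 2*m. moment L * ?I L)"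
    using finite_multi_indices
    by (simp add: sum.Plus sum_distrib_left sum_negf mult.assoc)
  finally show ?thesis
    by (simp add: right_diff_distrib sum_distrib_left mult_ac)
qed

text \<open>Since \<open>u\<close> vanishes outside \<Omega>, the integral extends to the whole
  space, where it is a Lebesgue integral and splits into terms.\<close>

lemma integral_op_H:
  fixes u :: "real^'n \<Rightarrow> real"
  assumes u: "smooth_fun u" and K: "compact K" "\<And>x. x \<notin> K \<Longrightarrow> u x = 0" "K \<subseteq> \<Omega>"
  shows "integral \<Omega> (\<lambda>x. u x * op_H m a u x)
    = (-1)^m * (\<Sum>\<alpha>\<in>multi_indices (2*m). a \<alpha> * (\<integral>x. u x * iter_partial (mi_list \<alpha>) u x \<partial>lborel))"
proof -
  have cu: "continuous_on UNIV u" using u by (rule smooth_fun_continuous)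
  have int_L: "integrable lborel (\<lambda>x. u x * iter_partial L u x)" for L
    using smooth_fun_continuous[OF smooth_fun_iter[OF u]]
    by (intro integrable_compact_support[of _ K] continuous_on_mult cu K) (auto intro: K)
  have eq: "u x * op_H m a u x = (-1)^m * (\<Sum>\<alpha>\<in>multi_indices (2*m). a \<alpha> * (u x * iter_partial (mi_list \<alpha>) u x))" for x
    by (simp add: op_H_def Dalpha_def mi_list_def sum_distrib_left mult_ac)
  have int: "integrable lborel (\<lambda>x. u x * op_H m a u x)"
    unfolding eq using int_L by simp
  have "integral \<Omega> (\<lambda>x. u x * op_H m a u x) = integral UNIV (\<lambda>x. if x \<in> \<Omega> then u x * op_H m a u x else 0)"
    by (rule integral_restrict_UNIV[symmetric])
  also have "(\<lambda>x. if x \<in> \<Omega> then u x * op_H m a u x else 0) = (\<lambda>x. u x * op_H m a u x)"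
    using K by (auto simp: fun_eq_iff)
  also have "integral UNIV \<dots> = (\<integral>x. u x * op_H m a u x \<partial>lborel)"
    using integral_lborel[OF int] by simp
  also have "\<dots> = (-1)^m * (\<Sum>\<alpha>\<in>multi_indices (2*m). a \<alpha> * (\<integral>x. u x * iter_partial (mi_list \<alpha>) u x \<partial>lborel))"
    unfolding eq using int_L by simp
  finally show ?thesis .
qed

end

section \<open>The Hardy-Rellich inequality on convex domains\<close>

theorem theorem3:
  fixes m :: nat and a :: "('n::finite \<Rightarrow> nat) \<Rightarrow> real"
    and \<Omega> :: "(real^'n) set" and u :: "real^'n \<Rightarrow> real"
  assumes m_pos: "m \<ge> 1"
    and elliptic: "\<And>\<xi>. \<xi> \<noteq> 0 \<Longrightarrow> symb_H m a \<xi> > 0"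
    and open_\<Omega>: "open \<Omega>" and convex_\<Omega>: "convex \<Omega>"
    and bdry: "frontier \<Omega> \<noteq> {}"
    and smooth: "smooth_fun u"
    and supp: "compact_support_in u \<Omega>"
  shows "integral \<Omega> (\<lambda>x. u x * op_H m a u x)
         \<ge> A_const m * (mu_H m a / M_H m a) *
           integral \<Omega> (\<lambda>x. (u x)^2 / (d_H m a \<Omega> x) ^ (2*m))"
proof -
  interpret elliptic_symbol m a using m_pos elliptic by unfold_locales
  define K where "K = closure {x. u x \<noteq> 0}"
  have K: "compact K" "K \<subseteq> \<Omega>" using supp by (auto simp: compact_support_in_def K_def)
  have uK: "u x = 0" if "x \<notin> K" for x
    using that closure_subset[of "{x. u x \<noteq> 0}"] by (auto simp: K_def)
  obtain D where D: "countable D" "D \<subseteq> frontier \<Omega>" "frontier \<Omega> \<subseteq> closure D"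
    by (rule separable)
  have "\<exists>n. \<forall>x\<in>\<Omega>. n \<bullet> x < n \<bullet> y" if "y \<in> frontier \<Omega>" for y
  proof (cases "\<Omega> = {}")
    case False
    have ri: "rel_interior \<Omega> = \<Omega>" using rel_interior_open[OF open_\<Omega>] .
    have y: "y \<in> closure \<Omega>" "y \<notin> rel_interior \<Omega>"
      using that open_\<Omega> by (auto simp: ri frontier_def interior_open)
    \<comment> \<open>Openness makes \<Omega> its own relative interior, so the separation is strict
      on all of \<Omega>. The normal obtained points inward, hence the change of sign.\<close>
    obtain n where "\<And>x. x \<in> rel_interior \<Omega> \<Longrightarrow> n \<bullet> y < n \<bullet> x"
      using supporting_hyperplane_relative_frontier[OF convex_\<Omega> y] by blast
    then show ?thesis by (intro exI[of _ "- n"]) (simp add: ri)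
  qed simp
  then obtain \<nu> where "\<And>y. y \<in> frontier \<Omega> \<Longrightarrow> \<forall>x\<in>\<Omega>. \<nu> y \<bullet> x < \<nu> y \<bullet> y" by metis
  then have \<nu>: "\<nu> y \<bullet> x < \<nu> y \<bullet> y" if "x \<in> \<Omega>" "y \<in> D" for x y using that D by blast
  let ?V = "measure lebesgue (ball (0::real^'n) 1)"
  define E where "E = (\<Sum>L | length L = 2*m. moment L * ((-1)^m * (\<integral>x. u x * iter_partial L u x \<partial>lborel)))"
  define P where "P = integral \<Omega> (\<lambda>x. u x * op_H m a u x)"
  define R where "R = integral \<Omega> (\<lambda>x. (u x)^2 / (d_H m a \<Omega> x) ^ (2*m))"
  have E0: "0 \<le> E" unfolding E_def
    by (rule weighted_energy_bound(1)[OF D bdry \<nu> smooth K(1) uK K(2) open_\<Omega> convex_\<Omega>])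
  have E1: "(\<integral>\<^sup>+x. ennreal (A_const m * (u x)^2) * ennreal (?V * mu_H m a / d_H m a \<Omega> x ^ (2*m)) \<partial>lborel) \<le> ennreal (?V * E)"
    unfolding E_def
    by (rule weighted_energy_bound(2)[OF D bdry \<nu> smooth K(1) uK K(2) open_\<Omega> convex_\<Omega>])
  have P_eq: "P = (-1)^m * (\<Sum>\<alpha>\<in>multi_indices (2*m). a \<alpha> * (\<integral>x. u x * iter_partial (mi_list \<alpha>) u x \<partial>lborel))"
    unfolding P_def by (rule integral_op_H[OF smooth K(1) uK K(2)])
  have EP: "E \<le> M_H m a * P"
    unfolding E_def P_eq
    by (rule energy_le_quadratic_form[OF smooth K(1) uK])
  have V: "?V > 0" by (rule measure_ball_pos)
  have "A_const m * mu_H m a * R \<le> E"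
  \<comment> \<open>the integral of a non-integrable function is \<open>0\<close>, so the weight need not be measurable a priori\<close>
  proof (cases "(\<lambda>x. (u x)^2 / (d_H m a \<Omega> x) ^ (2*m)) integrable_on \<Omega>")
    case False
    then have "R = 0" unfolding R_def by (rule not_integrable_integral)
    then show ?thesis using E0 by simp
  next
    case True
    let ?c = "A_const m * ?V * mu_H m a"
    have d: "0 \<le> d_H m a \<Omega> x" for x by (rule d_H_nonneg[OF D bdry \<nu>])
    have c: "0 \<le> ?c" using A_const_pos[of m] V mu_H_nonneg by simp
    have "((\<lambda>x. ?c * ((u x)^2 / (d_H m a \<Omega> x) ^ (2*m))) has_integral ?c * R) \<Omega>"
      unfolding R_def using True by (intro has_integral_mult_right integrable_integral)
    then have "ennreal (?c * R) = (\<integral>\<^sup>+x. ennreal (?c * ((u x)^2 / (d_H m a \<Omega> x) ^ (2*m))) * indicator \<Omega> x \<partial>lborel)"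
      using c d by (intro nn_integral_has_integral_lebesgue'[symmetric] mult_nonneg_nonneg[OF c] divide_nonneg_nonneg) auto
    also have "\<dots> \<le> (\<integral>\<^sup>+x. ennreal (A_const m * (u x)^2) * ennreal (?V * mu_H m a / d_H m a \<Omega> x ^ (2*m)) \<partial>lborel)"
    proof (rule nn_integral_mono)
      fix x
      have "ennreal (?c * ((u x)^2 / (d_H m a \<Omega> x) ^ (2*m))) = ennreal (A_const m * (u x)^2) * ennreal (?V * mu_H m a / d_H m a \<Omega> x ^ (2*m))"
        using A_const_pos[of m] V mu_H_nonneg d by (subst ennreal_mult[symmetric]) (auto simp: mult_ac)
      then show "ennreal (?c * ((u x)^2 / (d_H m a \<Omega> x) ^ (2*m))) * indicator \<Omega> x \<le> ennreal (A_const m * (u x)^2) * ennreal (?V * mu_H m a / d_H m a \<Omega> x ^ (2*m))"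
        by (simp add: indicator_def)
    qed
    also note E1
    \<comment> \<open>The volume of the ball, introduced when the spherical average was realised on
      the ball, occurs on both sides and cancels.\<close>
    finally have "?c * R \<le> ?V * E" using V E0 by (simp add: ennreal_le_iff)
    then have "?V * (A_const m * mu_H m a * R) \<le> ?V * E" by (simp add: mult_ac)
    then show ?thesis using V by (simp only: mult_le_cancel_left_pos)
  qed
  then have "A_const m * mu_H m a * R \<le> M_H m a * P" using EP by simp
  then have "A_const m * (mu_H m a / M_H m a) * R \<le> P"
    using M_H_pos by (simp add: field_simps)
  then show ?thesis by (simp add: P_def R_def)
qed

end
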